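(* Let $T$ be a lattice semistandard equivariant filling of a skew shape $\nu/\lambda$ (with $\nu\subseteq\Lambda$) of content $\mu$. Then: (I) $\mathtt{Eqrect}(T)$ is $\mu$-highest weight for any choice of rectification order; (II) the coefficient of $S_\mu$ in $\mathtt{Eqrect}(T)$ is independent of the rectification order; (III) this coefficient equals $\mathtt{apwt}(T)$.
   Context: Young diagrams are in English notation inside the $k\times(n-k)$ rectangle $\Lambda$; rows are numbered $1,\dots,k$ from the top and columns $1,\dots,n-k$ from the left. For a box $\mathsf x$ in row $r$ and column $c$, $\mathrm{Man}(\mathsf x)=k-r+c$ (this formula is also used for an imaginary box in row $0$ above $\Lambda$), and $\beta(\mathsf x)=t_{\mathrm{Man}(\mathsf x)}-t_{\mathrm{Man}(\mathsf x)+1}$; $\beta_i=t_i-t_{i+1}$. For $\lambda\subseteq\nu$, a horizontal edge of $\nu/\lambda$ is a horizontal unit segment on the upper or lower boundary of $\nu/\lambda$ or separating two of its boxes. An equivariant filling assigns a positive integer to each box and a (possibly empty) set of positive integers to each horizontal edge; it is semistandard if each box label is weakly smaller than the box label to its right, strictly smaller than all labels on its southern edge and the label in the box below, and strictly larger than all labels on its northern edge and the label in the box above. It is lattice if for every column $c$ and label $\mathfrak l$, the number of occurrences of $\mathfrak l$ (box or edge) in columns weakly right of $c$ is at least the number of occurrences of $\mathfrak l+1$ there. The content is $\mu=(\mu_1,\mu_2,\dots)$ where $\mu_i$ is the number of occurrences of $i$. An inner corner is a box of $\lambda$ maximally southeast in $\lambda$. Swaps (a tableau may contain one $\bullet$ in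 an otherwise unlabeled box): let $\mathsf x$ contain $\bullet$, $\mathsf y$ be the box right of it, $\mathsf z$ the box below; $\mathfrak b$ = smallest label on the lower edge of $\mathsf x$, or if empty the label of $\mathsf z$; $\mathfrak r$ = label of $\mathsf y$; $\mathcal N^T_{\mathsf w,\mathfrak l}$ = number of occurrences of $\mathfrak l$ in columns weakly right of $\mathsf w$. (I) If $\mathfrak b\le\mathfrak r$ (or no $\mathfrak r$) and $\mathfrak b$ is the label of $\mathsf z$: exchange $\bullet$ and $\mathfrak b$. (II) If $\mathfrak b\le\mathfrak r$ (or no $\mathfrak r$) and $\mathfrak b$ lies on the lower edge of $\mathsf x$: output $\beta(\mathsf x)T'+T''$ where $T'$ moves $\mathfrak b$ into $\mathsf x$ (removing the $\bullet$) and $T''$ moves $\mathfrak b$ to the upper edge of $\mathsf x$. (III) If $\mathfrak b>\mathfrak r$ (or no $\mathfrak b$) and the largest label $\mathfrak u$ on the upper edge of $\mathsf x$ equals $\mathfrak r$: move $\mathfrak u$ into $\mathsf x$, replace $\mathfrak r$ in $\mathsf y$ by $\bullet$ and put $\mathfrak r$ on the lower edge of $\mathsf y$. (IV) If $\mathfrak b>\mathfrak r$ (or no $\mathfrak b$) and (III) does not apply: let $\mathfrak m$ be largest such that (i) $\mathfrak m<\mathfrak b$ and $\mathfrak m\ge$ the label in the box left of $\mathsf x$ (if any), (ii) $\mathcal N^T_{\mathsf y,\mathfrak l}=\mathcal N^T_{\mathsf y,\mathfrak r}$ for $\mathfrak r\le\mathfrak l\le\mathfrak m$, (iii) $\mathfrak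 r+1,\dots,\mathfrak m$ lie on the lower edge of $\mathsf y$; then remove $\mathfrak r$ from $\mathsf y$ and $\mathfrak r+1,\dots,\mathfrak m$ from the lower edge of $\mathsf y$, put $\mathfrak m$ into $\mathsf x$, add $\mathfrak r,\dots,\mathfrak m-1$ to the upper edge of $\mathsf x$, and put $\bullet$ in $\mathsf y$. $\mathtt{Eqjdt}_{\mathsf x}(T)$: put $\bullet$ in the inner corner $\mathsf x$ and swap; the result is a formal sum with coefficients in $\mathbb Z[\beta_1,\dots,\beta_{n-1}]$; keep swapping each tableau whose $\bullet$ has a label in the box to its right, on its lower edge, or in the box below; finally erase the $\bullet$'s. $\mathtt{Eqrect}(T)$: pick an inner corner $\mathsf x$, replace $T$ by $\mathtt{Eqjdt}_{\mathsf x}(T)$; for each tableau $U$ in the formal sum having an inner corner, pick one, $\mathsf x'$, and replace $U$ by $\mathtt{Eqjdt}_{\mathsf x'}(U)$; repeat until no tableau has an inner corner (i.e., all are of straight shape). The choices of inner corners constitute the rectification order. A straight-shape tableau is regular if it has no edge labels. $S_\mu$ is the regular tableau of shape $\mu$ whose $i$-th row consists of $i$'s. For $T$ of content $\mu$, $\mathtt{Eqrect}(T)$ is $\mu$-highest weight if $S_\mu$ is the only regular tableau appearing in it with nonzero coefficient (possibly none appears). A priori weight: a label $i$ of $T$ is too high if (i) it is an edge label lying on a horizontal edge weakly above the upper edge of the box of row $i$ in its column, except when it lies on the upper edge of a box $\mathsf x$ in row exactly $i$ and a resuscitation swap (III) applicable to $T$ at $\mathsf x$ moves this $i$ into $\mathsf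 x$; or (ii) it is a box label in a row strictly above row $i$. If some label is too high, $\mathtt{apwt}(T)=0$. Otherwise, for an edge label $i$ lying on the lower edge of a box $\mathsf x$ in row $r$ ($r=0$ if it is on the top edge of $\Lambda$), set $\mathtt{apfactor}(i)=t_{\mathrm{Man}(\mathsf x)}-t_{\mathrm{Man}(\mathsf x)+r-i+1+N}$, where $N$ is the number of occurrences of $i$ strictly to the right of $\mathsf x$; and $\mathtt{apwt}(T)=\prod\mathtt{apfactor}(i)$ over all edge labels $i$ of $T$. *)

theory Defs
  imports "HOL-Library.Poly_Mapping"
begin

section \<open>Coefficients and formal sums\<close>

text \<open>The ring of integer polynomials in \<open>t\<^sub>0, t\<^sub>1, \<dots>\<close>: exponent vectors with finite
  support, mapped to integer coefficients with finite support. Only positive indices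
  occur for the tableaux of interest.\<close>

type_synonym poly_t = "(nat \<Rightarrow>\<^sub>0 nat) \<Rightarrow>\<^sub>0 int"

definition tvar :: "nat \<Rightarrow> poly_t" where
  "tvar i = Poly_Mapping.single (Poly_Mapping.single i 1) 1"

definition scale :: "'r::mult_zero \<Rightarrow> ('a \<Rightarrow>\<^sub>0 'r) \<Rightarrow> ('a \<Rightarrow>\<^sub>0 'r)" where
  "scale a F = Poly_Mapping.map (\<lambda>b. a * b) F"

text \<open>Replace every term of a formal sum \<open>F\<close> according to \<open>f\<close>, linearly.\<close>

definition substitute :: "('a \<Rightarrow> ('b \<Rightarrow>\<^sub>0 'r)) \<Rightarrow> ('a \<Rightarrow>\<^sub>0 'r) \<Rightarrow> ('b \<Rightarrow>\<^sub>0 'r::comm_ring_1)" where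
  "substitute f F = (\<Sum>U \<in> Poly_Mapping.keys F. scale (Poly_Mapping.lookup F U) (f U))"

primrec iterate :: "(nat \<Rightarrow> 'a \<Rightarrow> 'a) \<Rightarrow> nat \<Rightarrow> 'a \<Rightarrow> 'a" where
  "iterate s 0 F = F"
| "iterate s (Suc m) F = s m (iterate s m F)"

definition repeat_until :: "(nat \<Rightarrow> 'a \<Rightarrow> 'a) \<Rightarrow> ('a \<Rightarrow> bool) \<Rightarrow> 'a \<Rightarrow> 'a" where
  "repeat_until s P F = iterate s (LEAST m. P (iterate s m F)) F"


section \<open>Shapes\<close>

text \<open>A box is a pair (row, column), both counted from 1. A Young diagram is the set of its
  boxes. The pair \<open>(e, c)\<close> also names the horizontal unit segment in column \<open>c\<close> which is
  the lower edge of box \<open>(e, c)\<close> and the upper edge of box \<open>(e + 1, c)\<close>; for \<open>e = 0\<close> it lies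
  on the top edge of the ambient rectangle.\<close>

type_synonym box = "nat \<times> nat"
type_synonym edge = "nat \<times> nat"

definition rectangle :: "nat \<Rightarrow> nat \<Rightarrow> box set" where
  "rectangle k n = {1..k} \<times> {1..n - k}"

definition young_diagram :: "box set \<Rightarrow> bool" where
  "young_diagram D \<longleftrightarrow> finite D \<and>
     (\<forall>r c. (r, c) \<in> D \<longrightarrow> 1 \<le> r \<and> 1 \<le> c \<and> {1..r} \<times> {1..c} \<subseteq> D)"

definition inner_corners_of :: "box set \<Rightarrow> box set" where
  "inner_corners_of D = {(r, c). (r, c) \<in> D \<and> (r + 1, c) \<notin> D \<and> (r, c + 1) \<notin> D}"

text \<open>The horizontal segments of the lower border of \<open>D\<close>, viewed as a lattice path from the
  southwest to the northeast corner of the rectangle.\<close>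

definition southern_border :: "nat \<Rightarrow> nat \<Rightarrow> box set \<Rightarrow> edge set" where
  "southern_border k n D =
     {(e, c). c \<in> {1..n - k} \<and> (e = 0 \<or> (e, c) \<in> D) \<and> (e + 1, c) \<notin> D}"

text \<open>The upper boundary of \<open>\<nu>/\<lambda>\<close> is the southern border of \<open>\<lambda>\<close>, its lower boundary that of
  \<open>\<nu>\<close>. In a column in which \<open>\<nu>/\<lambda>\<close> has no box the two coincide in a single edge.\<close>

definition horizontal_edges :: "nat \<Rightarrow> nat \<Rightarrow> box set \<Rightarrow> box set \<Rightarrow> edge set" where
  "horizontal_edges k n lam nu = southern_border k n lam \<union> southern_border k n nu \<union>
     {(e, c). (e, c) \<in> nu - lam \<and> (e + 1, c) \<in> nu - lam}"


section \<open>Tableaux\<close>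

text \<open>A tableau of shape \<open>out_shape / in_shape\<close>. Boxes carrying no label are mapped to
  \<open>None\<close>; the box marked by the bullet, if any, is one of these.\<close>

record tableau =
  in_shape :: "box set"
  out_shape :: "box set"
  label :: "box \<Rightarrow> nat option"
  elabels :: "edge \<Rightarrow> nat set"
  bullet :: "box option"

type_synonym tableau_sum = "tableau \<Rightarrow>\<^sub>0 poly_t"

definition equivariant_filling :: "nat \<Rightarrow> nat \<Rightarrow> box set \<Rightarrow> box set \<Rightarrow> tableau \<Rightarrow> bool" where
  "equivariant_filling k n lam nu T \<longleftrightarrow>
     in_shape T = lam \<and> out_shape T = nu \<and> bullet T = None \<and>
     dom (label T) = nu - lam \<and>
     (\<forall>b l. label T b = Some l \<longrightarrow> 1 \<le> l) \<and>
     (\<forall>e. finite (elabels T e) \<and> (\<forall>l \<in> elabels T e. 1 \<le> l)) \<and>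
     (\<forall>e. e \<notin> horizontal_edges k n lam nu \<longrightarrow> elabels T e = {})"

definition semistandard :: "tableau \<Rightarrow> bool" where
  "semistandard T \<longleftrightarrow> (\<forall>r c l. label T (r, c) = Some l \<longrightarrow>
     (\<forall>l'. label T (r, c + 1) = Some l' \<longrightarrow> l \<le> l') \<and>
     (\<forall>l' \<in> elabels T (r, c). l < l') \<and>
     (\<forall>l'. label T (r + 1, c) = Some l' \<longrightarrow> l < l') \<and>
     (\<forall>l' \<in> elabels T (r - 1, c). l' < l) \<and>
     (\<forall>l'. label T (r - 1, c) = Some l' \<longrightarrow> l' < l))"

text \<open>Number of occurrences of \<open>l\<close>, in boxes and on edges, in columns weakly right of \<open>c\<close>.\<close>

definition occ_from :: "tableau \<Rightarrow> nat \<Rightarrow> nat \<Rightarrow> nat" where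
  "occ_from T c l =
     card {(r, c'). c \<le> c' \<and> label T (r, c') = Some l} +
     card {(e, c'). c \<le> c' \<and> l \<in> elabels T (e, c')}"

definition lattice :: "tableau \<Rightarrow> bool" where
  "lattice T \<longleftrightarrow> (\<forall>c \<ge> 1. \<forall>l \<ge> 1. occ_from T c (l + 1) \<le> occ_from T c l)"

definition content :: "tableau \<Rightarrow> nat \<Rightarrow> nat" where
  "content T i = card {b. label T b = Some i} + card {e. i \<in> elabels T e}"

definition straight :: "tableau \<Rightarrow> bool" where
  "straight T \<longleftrightarrow> in_shape T = {}"

definition regular :: "tableau \<Rightarrow> bool" where
  "regular T \<longleftrightarrow> straight T \<and> (\<forall>e. elabels T e = {})"

definition diagram_of :: "(nat \<Rightarrow> nat) \<Rightarrow> box set" where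
  "diagram_of mu = {(i, j). 1 \<le> i \<and> 1 \<le> j \<and> j \<le> mu i}"

definition S_tab :: "(nat \<Rightarrow> nat) \<Rightarrow> tableau" where
  "S_tab mu = \<lparr> in_shape = {}, out_shape = diagram_of mu,
     label = (\<lambda>(i, j). if (i, j) \<in> diagram_of mu then Some i else None),
     elabels = (\<lambda>_. {}), bullet = None \<rparr>"


section \<open>Swaps\<close>

text \<open>Here \<open>r = 0\<close> is allowed. For \<open>r \<le> k\<close> the subtraction is exact.\<close>

definition man :: "nat \<Rightarrow> box \<Rightarrow> nat" where
  "man k = (\<lambda>(r, c). k - r + c)"

definition beta :: "nat \<Rightarrow> box \<Rightarrow> poly_t" where
  "beta k x = tvar (man k x) - tvar (man k x + 1)"

definition right_of :: "box \<Rightarrow> box" where "right_of = (\<lambda>(r, c). (r, c + 1))"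
definition left_of :: "box \<Rightarrow> box" where "left_of = (\<lambda>(r, c). (r, c - 1))"
definition below :: "box \<Rightarrow> box" where "below = (\<lambda>(r, c). (r + 1, c))"
definition lower_edge :: "box \<Rightarrow> edge" where "lower_edge x = x"
definition upper_edge :: "box \<Rightarrow> edge" where "upper_edge = (\<lambda>(r, c). (r - 1, c))"

definition b_label :: "tableau \<Rightarrow> box \<Rightarrow> nat option" where
  "b_label T x = (if elabels T (lower_edge x) \<noteq> {} then Some (Min (elabels T (lower_edge x)))
                  else label T (below x))"

definition r_label :: "tableau \<Rightarrow> box \<Rightarrow> nat option" where
  "r_label T x = label T (right_of x)"

text \<open>The alternatives of the swap rules: \<open>b \<le> r\<close> or there is no \<open>r\<close> (rules I and II), and
  \<open>b > r\<close> or there is no \<open>b\<close> (rules III and IV).\<close>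

definition goes_vertical :: "tableau \<Rightarrow> box \<Rightarrow> bool" where
  "goes_vertical T x \<longleftrightarrow> (\<exists>b. b_label T x = Some b \<and> (\<forall>r. r_label T x = Some r \<longrightarrow> b \<le> r))"

definition goes_horizontal :: "tableau \<Rightarrow> box \<Rightarrow> bool" where
  "goes_horizontal T x \<longleftrightarrow> (\<exists>r. r_label T x = Some r \<and> (\<forall>b. b_label T x = Some b \<longrightarrow> r < b))"

definition vertical_swap :: "tableau \<Rightarrow> box \<Rightarrow> tableau" where
  "vertical_swap T x = T\<lparr> label := (label T)(x := label T (below x), below x := None),
                          bullet := Some (below x) \<rparr>"

definition expansion_swap :: "nat \<Rightarrow> tableau \<Rightarrow> box \<Rightarrow> tableau_sum" where
  "expansion_swap k T x =
     (let b = Min (elabels T (lower_edge x));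
          E = (elabels T)(lower_edge x := elabels T (lower_edge x) - {b});
          T' = T\<lparr> label := (label T)(x := Some b), elabels := E, bullet := None \<rparr>;
          T'' = T\<lparr> elabels := E(upper_edge x := insert b (E (upper_edge x))) \<rparr>
      in Poly_Mapping.single T' (beta k x) + Poly_Mapping.single T'' 1)"

definition resuscitates :: "tableau \<Rightarrow> box \<Rightarrow> bool" where
  "resuscitates T x \<longleftrightarrow> goes_horizontal T x \<and> elabels T (upper_edge x) \<noteq> {} \<and>
     r_label T x = Some (Max (elabels T (upper_edge x)))"

definition resuscitation_swap :: "tableau \<Rightarrow> box \<Rightarrow> tableau" where
  "resuscitation_swap T x =
     (let y = right_of x; u = Max (elabels T (upper_edge x)); r = the (r_label T x);
          E = (elabels T)(upper_edge x := elabels T (upper_edge x) - {u})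
      in T\<lparr> label := (label T)(x := Some u, y := None),
            elabels := E(lower_edge y := insert r (E (lower_edge y))),
            bullet := Some y \<rparr>)"

definition horizontal_m :: "tableau \<Rightarrow> box \<Rightarrow> nat" where
  "horizontal_m T x =
     (let y = right_of x; r = the (r_label T x)
      in Max {m. (\<forall>b. b_label T x = Some b \<longrightarrow> m < b) \<and>
                 (\<forall>l. label T (left_of x) = Some l \<longrightarrow> l \<le> m) \<and>
                 (\<forall>l. r \<le> l \<and> l \<le> m \<longrightarrow> occ_from T (snd y) l = occ_from T (snd y) r) \<and>
                 {r + 1..m} \<subseteq> elabels T (lower_edge y)})"

definition horizontal_swap :: "tableau \<Rightarrow> box \<Rightarrow> tableau" where
  "horizontal_swap T x =
     (let y = right_of x; r = the (r_label T x); m = horizontal_m T x;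
          E = (elabels T)(lower_edge y := elabels T (lower_edge y) - {r + 1..m})
      in T\<lparr> label := (label T)(x := Some m, y := None),
            elabels := E(upper_edge x := E (upper_edge x) \<union> {r..<m}),
            bullet := Some y \<rparr>)"

definition can_swap :: "tableau \<Rightarrow> bool" where
  "can_swap T \<longleftrightarrow> (\<exists>x. bullet T = Some x \<and>
     (label T (right_of x) \<noteq> None \<or> elabels T (lower_edge x) \<noteq> {} \<or> label T (below x) \<noteq> None))"

text \<open>Only meant for tableaux satisfying \<open>can_swap\<close>.\<close>

definition swap :: "nat \<Rightarrow> tableau \<Rightarrow> tableau_sum" where
  "swap k T = (let x = the (bullet T) in
     if goes_vertical T x then
       (if elabels T (lower_edge x) = {} then Poly_Mapping.single (vertical_swap T x) 1
        else expansion_swap k T x)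
     else if resuscitates T x then Poly_Mapping.single (resuscitation_swap T x) 1
     else Poly_Mapping.single (horizontal_swap T x) 1)"


section \<open>Equivariant jeu de taquin and rectification\<close>

definition put_bullet :: "box \<Rightarrow> tableau \<Rightarrow> tableau" where
  "put_bullet x T = T\<lparr> in_shape := in_shape T - {x}, bullet := Some x \<rparr>"

text \<open>A box vacated by the bullet is no longer part of the shape.\<close>

definition erase_bullet :: "tableau \<Rightarrow> tableau" where
  "erase_bullet T = (case bullet T of None \<Rightarrow> T
     | Some x \<Rightarrow> T\<lparr> out_shape := out_shape T - {x}, bullet := None \<rparr>)"

definition swap_step :: "nat \<Rightarrow> tableau_sum \<Rightarrow> tableau_sum" where
  "swap_step k F =
     substitute (\<lambda>U. if can_swap U then swap k U else Poly_Mapping.single U 1) F"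

definition Eqjdt :: "nat \<Rightarrow> box \<Rightarrow> tableau \<Rightarrow> tableau_sum" where
  "Eqjdt k x T = substitute (\<lambda>U. Poly_Mapping.single (erase_bullet U) 1)
     (repeat_until (\<lambda>_. swap_step k) (\<lambda>F. \<forall>U \<in> Poly_Mapping.keys F. \<not> can_swap U)
        (Poly_Mapping.single (put_bullet x T) 1))"

definition inner_corners :: "tableau \<Rightarrow> box set" where
  "inner_corners T = inner_corners_of (in_shape T)"

text \<open>A rectification order \<open>\<rho>\<close> chooses, at each stage \<open>m\<close> and for each tableau \<open>U\<close> of the
  formal sum then present, an inner corner \<open>\<rho> m U\<close> of \<open>U\<close> if there is one.\<close>

definition rectification_order :: "(nat \<Rightarrow> tableau \<Rightarrow> box) \<Rightarrow> bool" where
  "rectification_order \<rho> \<longleftrightarrow>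
     (\<forall>m U. inner_corners U \<noteq> {} \<longrightarrow> \<rho> m U \<in> inner_corners U)"

definition rect_step :: "nat \<Rightarrow> (tableau \<Rightarrow> box) \<Rightarrow> tableau_sum \<Rightarrow> tableau_sum" where
  "rect_step k \<sigma> F = substitute
     (\<lambda>U. if inner_corners U \<noteq> {} then Eqjdt k (\<sigma> U) U else Poly_Mapping.single U 1) F"

definition Eqrect :: "nat \<Rightarrow> (nat \<Rightarrow> tableau \<Rightarrow> box) \<Rightarrow> tableau \<Rightarrow> tableau_sum" where
  "Eqrect k \<rho> T = repeat_until (\<lambda>m. rect_step k (\<rho> m))
     (\<lambda>F. \<forall>U \<in> Poly_Mapping.keys F. inner_corners U = {}) (Poly_Mapping.single T 1)"

definition highest_weight :: "(nat \<Rightarrow> nat) \<Rightarrow> tableau_sum \<Rightarrow> bool" where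
  "highest_weight mu F \<longleftrightarrow>
     (\<forall>U. regular U \<and> Poly_Mapping.lookup F U \<noteq> 0 \<longrightarrow> U = S_tab mu)"


section \<open>The a priori weight\<close>

text \<open>The edge \<open>(e, c)\<close> is weakly above the upper edge of the box in row \<open>i\<close> iff \<open>e \<le> i - 1\<close>.\<close>

definition edge_too_high :: "tableau \<Rightarrow> edge \<Rightarrow> nat \<Rightarrow> bool" where
  "edge_too_high T = (\<lambda>(e, c) i. i \<in> elabels T (e, c) \<and> e < i \<and>
     \<not> ((e, c) = upper_edge (i, c) \<and> bullet T = Some (i, c) \<and> resuscitates T (i, c) \<and>
        i = Max (elabels T (upper_edge (i, c)))))"

definition box_too_high :: "tableau \<Rightarrow> box \<Rightarrow> nat \<Rightarrow> bool" where
  "box_too_high T = (\<lambda>(r, c) i. label T (r, c) = Some i \<and> r < i)"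

text \<open>For a label that is not too high one has \<open>i \<le> r + 1\<close>, so that the natural number
  \<open>man k (r, c) + r + 1 + N - i\<close> agrees with \<open>Man + r - i + 1 + N\<close>.\<close>

definition apfactor :: "nat \<Rightarrow> tableau \<Rightarrow> edge \<Rightarrow> nat \<Rightarrow> poly_t" where
  "apfactor k T = (\<lambda>(r, c) i.
     tvar (man k (r, c)) - tvar (man k (r, c) + r + 1 + occ_from T (c + 1) i - i))"

definition apwt :: "nat \<Rightarrow> tableau \<Rightarrow> poly_t" where
  "apwt k T =
     (if (\<exists>e i. edge_too_high T e i) \<or> (\<exists>b i. box_too_high T b i) then 0
      else \<Prod>(e, i) \<in> {(e, i). i \<in> elabels T e}. apfactor k T e i)"

end

(* The a priori weight is an invariant of the swaps: if a swap turns T into the formal sum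
   of c_j T_j, then apwt(T) is the sum of c_j apwt(T_j). The reason is that the factor of an edge
   label i on the edge (e, c) with N copies of i to its right is t_(k-e+c) - t_(k+c+1+N-i), whose
   second index does not depend on e. In an expansion swap the box term beta and the edge term
   therefore telescope to the old factor, and when a resuscitation or horizontal swap shifts labels
   one column left (or right), N or i shifts along. Where a swap moves a label to a too high
   position, latticeness makes the old tableau have weight zero as well, or, in the expansion swap,
   makes the factor of the moved label vanish. On semistandard lattice tableaux of straight shape
   the weight is 1 for S_mu and 0 for all others, as every edge label is then too high. So the
   coefficient of S_mu in the rectification is the weight of T. *)

theory Submission
  imports Defs
begin

section \<open>Linear functionals on formal sums\<close>

text \<open>Semistandardness alone is not an invariant: after a horizontal swap the row may decrease
  across the bullet. The class \<open>good\<close> therefore records, in \<open>bullet_ok\<close>,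
  why such a descent heals: the left label \<open>a\<close> meets the conditions on the label that
  the next swap moves left, so the largest admissible label is at least \<open>a\<close>.
  Latticeness survives by the same maximality: in the columns right of the bullet the chosen label
  \<open>m\<close> occurs strictly more often than \<open>m + 1\<close>, so one copy of
  \<open>m\<close> may leave them. Column strictness is demanded of all pairs in a column; hence a
  column holds each label at most once, multiplicities count columns, and every swap but the
  horizontal one leaves the set of columns of each label unchanged. The exception for too high
  labels covers the moment when an expansion has lifted a label \<open>R\<close> to the upper edge
  of row \<open>R\<close> and a resuscitation follows; without it the edge term would lose a weight
  that need not be zero. Since the iterations stop at a least time, termination is proved along with
  the invariants.\<close>

definition lin_ext :: "('a \<Rightarrow> 'r) \<Rightarrow> ('a \<Rightarrow>\<^sub>0 'r) \<Rightarrow> 'r::comm_ring_1" where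
  "lin_ext g F = (\<Sum>U \<in> Poly_Mapping.keys F. Poly_Mapping.lookup F U * g U)"

lemma lin_ext_superset:
  assumes "finite S" "Poly_Mapping.keys F \<subseteq> S"
  shows "lin_ext g F = (\<Sum>U \<in> S. Poly_Mapping.lookup F U * g U)"
  unfolding lin_ext_def
  by (rule sum.mono_neutral_left) (use assms in \<open>auto simp: in_keys_iff\<close>)

lemma lookup_scale: "Poly_Mapping.lookup (scale a F) U = a * Poly_Mapping.lookup F U"
  unfolding scale_def by (simp add: map.rep_eq when_def)

lemma keys_scale: "Poly_Mapping.keys (scale a F) \<subseteq> Poly_Mapping.keys F"
  by (auto simp: in_keys_iff lookup_scale)

lemma lin_ext_add: "lin_ext g (F + G) = lin_ext g F + lin_ext g G"
proof -
  let ?S = "Poly_Mapping.keys F \<union> Poly_Mapping.keys G"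
  have "lin_ext g (F + G) = (\<Sum>U \<in> ?S. Poly_Mapping.lookup (F + G) U * g U)"
    using Poly_Mapping.keys_add[of F G] by (intro lin_ext_superset) auto
  also have "\<dots> = (\<Sum>U \<in> ?S. Poly_Mapping.lookup F U * g U) + (\<Sum>U \<in> ?S. Poly_Mapping.lookup G U * g U)"
    by (simp add: lookup_add algebra_simps sum.distrib)
  also have "\<dots> = lin_ext g F + lin_ext g G"
    using lin_ext_superset[of ?S F g] lin_ext_superset[of ?S G g] by auto
  finally show ?thesis .
qed

lemma lin_ext_scale: "lin_ext g (scale a F) = a * lin_ext g F"
proof -
  have "lin_ext g (scale a F) = (\<Sum>U \<in> Poly_Mapping.keys F. a * (Poly_Mapping.lookup F U * g U))"
    by (subst lin_ext_superset[OF finite_keys keys_scale]) (simp add: lookup_scale mult.assoc)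
  then show ?thesis by (simp add: lin_ext_def sum_distrib_left)
qed

lemma lin_ext_zero [simp]: "lin_ext g 0 = 0"
  by (simp add: lin_ext_def)

lemma lin_ext_single [simp]: "lin_ext g (Poly_Mapping.single U a) = a * g U"
  by (subst lin_ext_superset[where S = "{U}"]) auto

lemma lin_ext_sum: "lin_ext g (\<Sum>i \<in> I. F i) = (\<Sum>i \<in> I. lin_ext g (F i))"
  by (induction I rule: infinite_finite_induct) (auto simp: lin_ext_add)

lemma lin_ext_substitute:
  "lin_ext g (substitute f F) = (\<Sum>U \<in> Poly_Mapping.keys F. Poly_Mapping.lookup F U * lin_ext g (f U))"
  by (simp add: substitute_def lin_ext_sum lin_ext_scale)

lemma lin_ext_substitute_cong:
  assumes "\<And>U. U \<in> Poly_Mapping.keys F \<Longrightarrow> lin_ext g (f U) = g' U"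
  shows "lin_ext g (substitute f F) = lin_ext g' F"
  using assms by (simp add: lin_ext_substitute) (simp add: lin_ext_def)

lemma keys_sum_subset: "Poly_Mapping.keys (\<Sum>i \<in> I. F i) \<subseteq> (\<Union>i \<in> I. Poly_Mapping.keys (F i))"
  by (induction I rule: infinite_finite_induct) (use Poly_Mapping.keys_add in fastforce)+

text \<open>Only an inclusion, since terms coming from different \<open>U\<close> may cancel. It
  suffices to carry a property of all terms through a substitution.\<close>

lemma keys_substitute:
  "Poly_Mapping.keys (substitute f F) \<subseteq> (\<Union>U \<in> Poly_Mapping.keys F. Poly_Mapping.keys (f U))"
  unfolding substitute_def using keys_sum_subset keys_scale by fastforce

lemma keys_substituteE:
  assumes "V \<in> Poly_Mapping.keys (substitute f F)"
  obtains U where "U \<in> Poly_Mapping.keys F" "V \<in> Poly_Mapping.keys (f U)"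
  using assms keys_substitute by fastforce

text \<open>The least stopping time in \<open>repeat_until\<close> means nothing until some time is
  known to work. The index of \<open>Q\<close> is a budget: it drops by one per step, and an
  exhausted budget forces \<open>P\<close>. The actual stopping time is at most \<open>b\<close>, so
  \<open>Q\<close> is still known there.\<close>

lemma repeat_until_reaches:
  assumes start: "Q b F"
    and step: "\<And>j m F. Q (Suc j) F \<Longrightarrow> Q j (s m F)"
    and stop: "\<And>F. Q 0 F \<Longrightarrow> P F"
  shows "P (repeat_until s P F) \<and> (\<exists>j. Q j (repeat_until s P F))"
proof -
  have Q: "m \<le> b \<Longrightarrow> Q (b - m) (iterate s m F)" for m
  proof (induction m)
    case 0
    then show ?case using start by simp
  next
    case (Suc m)
    then have "Q (Suc (b - Suc m)) (iterate s m F)" by (simp add: Suc_diff_Suc)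
    then show ?case using step by simp
  qed
  have "P (iterate s b F)" using Q[of b] stop by simp
  then have "P (repeat_until s P F)" "(LEAST m. P (iterate s m F)) \<le> b"
    unfolding repeat_until_def by (rule LeastI, rule Least_le)
  then show ?thesis using Q unfolding repeat_until_def by blast
qed

section \<open>Good tableaux\<close>

text \<open>The last clause keeps labelled edges weakly below the lower border of the inner shape
  and weakly above that of the outer one; in a column without boxes exactly one edge
  remains.\<close>

definition well_formed :: "nat \<Rightarrow> nat \<Rightarrow> tableau \<Rightarrow> bool" where
  "well_formed k n T \<longleftrightarrow>
     young_diagram (in_shape T) \<and> young_diagram (out_shape T) \<and>
     in_shape T \<subseteq> out_shape T \<and> out_shape T \<subseteq> rectangle k n \<and>
     set_option (bullet T) \<subseteq> out_shape T - in_shape T \<and>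
     dom (label T) = out_shape T - in_shape T - set_option (bullet T) \<and>
     (\<forall>x l. label T x = Some l \<longrightarrow> 1 \<le> l) \<and>
     (\<forall>e. finite (elabels T e)) \<and>
     (\<forall>e c l. l \<in> elabels T (e, c) \<longrightarrow>
        1 \<le> l \<and> c \<in> {1..n - k} \<and> (e = 0 \<or> (e, c) \<in> out_shape T) \<and> (e + 1, c) \<notin> in_shape T)"

text \<open>All pairs of a column are compared instead of neighbours, because the bullet interrupts
  the chain of neighbours.\<close>

definition column_strict :: "tableau \<Rightarrow> bool" where
  "column_strict T \<longleftrightarrow>
     (\<forall>r r' c l l'. label T (r, c) = Some l \<longrightarrow> label T (r', c) = Some l' \<longrightarrow> r < r' \<longrightarrow> l < l') \<and>
     (\<forall>r e c l l'. label T (r, c) = Some l \<longrightarrow> l' \<in> elabels T (e, c) \<longrightarrow> r \<le> e \<longrightarrow> l < l') \<and>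
     (\<forall>e r c l l'. l \<in> elabels T (e, c) \<longrightarrow> label T (r, c) = Some l' \<longrightarrow> e < r \<longrightarrow> l < l') \<and>
     (\<forall>e e' c l l'. l \<in> elabels T (e, c) \<longrightarrow> l' \<in> elabels T (e', c) \<longrightarrow> e < e' \<longrightarrow> l < l')"

definition row_weak :: "tableau \<Rightarrow> bool" where
  "row_weak T \<longleftrightarrow> (\<forall>r c l l'. label T (r, c) = Some l \<longrightarrow> label T (r, c + 1) = Some l' \<longrightarrow> l \<le> l')"

text \<open>Across the bullet the row may decrease, from \<open>a\<close> to \<open>s\<close>. This happens only after a
  horizontal swap, and then the next swap is again horizontal and restores the row.\<close>

definition bullet_ok :: "tableau \<Rightarrow> bool" where
  "bullet_ok T \<longleftrightarrow> (\<forall>r c. bullet T = Some (r, c) \<longrightarrow>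
     (\<forall>a. label T (r, c - 1) = Some a \<longrightarrow> (\<forall>l \<in> elabels T (r, c). a \<le> l)) \<and>
     (\<forall>s. label T (r, c + 1) = Some s \<longrightarrow>
        (\<forall>u \<in> elabels T (r - 1, c). u \<le> s) \<and>
        (\<forall>a. label T (r, c - 1) = Some a \<longrightarrow> a \<le> s \<or>
           s \<notin> elabels T (r - 1, c) \<and> {s + 1..a} \<subseteq> elabels T (r, c + 1) \<and>
           (\<forall>l. s \<le> l \<and> l \<le> a \<longrightarrow> occ_from T (c + 1) l = occ_from T (c + 1) s) \<and>
           (\<forall>l \<in> elabels T (r, c). a < l))))"

definition good :: "nat \<Rightarrow> nat \<Rightarrow> (nat \<Rightarrow> nat) \<Rightarrow> tableau \<Rightarrow> bool" where
  "good k n mu T \<longleftrightarrow> well_formed k n T \<and> column_strict T \<and> row_weak T \<and> lattice T \<and>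
     content T = mu \<and> bullet_ok T"

section \<open>Positions and multiplicities of labels, column by column\<close>

definition occurs :: "tableau \<Rightarrow> nat \<Rightarrow> nat \<Rightarrow> bool" where
  "occurs T c l \<longleftrightarrow> (\<exists>r. label T (r, c) = Some l) \<or> (\<exists>e. l \<in> elabels T (e, c))"

lemma column_strictD:
  assumes "column_strict T"
  shows "label T (r, c) = Some l \<Longrightarrow> label T (r', c) = Some l' \<Longrightarrow> r < r' \<Longrightarrow> l < l'"
    and "label T (r, c) = Some l \<Longrightarrow> l' \<in> elabels T (e, c) \<Longrightarrow> r \<le> e \<Longrightarrow> l < l'"
    and "l \<in> elabels T (e, c) \<Longrightarrow> label T (r, c) = Some l' \<Longrightarrow> e < r \<Longrightarrow> l < l'"
    and "l \<in> elabels T (e, c) \<Longrightarrow> l' \<in> elabels T (e', c) \<Longrightarrow> e < e' \<Longrightarrow> l < l'"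
  using assms unfolding column_strict_def by blast+

lemma young_diagram_down:
  "young_diagram D \<Longrightarrow> (r, c) \<in> D \<Longrightarrow> 1 \<le> r' \<Longrightarrow> r' \<le> r \<Longrightarrow> 1 \<le> c' \<Longrightarrow> c' \<le> c \<Longrightarrow> (r', c') \<in> D"
  by (rule subsetD[of "{1..r} \<times> {1..c}"]) (auto simp: young_diagram_def)

lemma well_formed_label_iff:
  assumes "well_formed k n T"
  shows "(\<exists>l. label T x = Some l) \<longleftrightarrow> x \<in> out_shape T \<and> x \<notin> in_shape T \<and> bullet T \<noteq> Some x"
proof -
  have "x \<in> dom (label T) \<longleftrightarrow> x \<in> out_shape T - in_shape T - set_option (bullet T)"
    using assms by (simp add: well_formed_def)
  then show ?thesis by (cases "bullet T") (auto simp: domIff)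
qed

lemma well_formed_out:
  assumes "well_formed k n T" "(r, c) \<in> out_shape T"
  shows "1 \<le> r" "r \<le> k" "1 \<le> c" "c \<le> n - k"
  using assms by (auto simp: well_formed_def rectangle_def)

lemma well_formed_edge:
  assumes "well_formed k n T" "l \<in> elabels T (e, c)"
  shows "1 \<le> l" "1 \<le> c" "c \<le> n - k" "e = 0 \<or> (e, c) \<in> out_shape T" "(e + 1, c) \<notin> in_shape T" "e \<le> k"
proof -
  show a: "1 \<le> l" "1 \<le> c" "c \<le> n - k" "e = 0 \<or> (e, c) \<in> out_shape T" "(e + 1, c) \<notin> in_shape T"
    using assms by (auto simp: well_formed_def)
  show "e \<le> k" using a(4) well_formed_out[OF assms(1)] by auto
qed

lemma well_formed_label:
  assumes "well_formed k n T" "label T (r, c) = Some l"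
  shows "1 \<le> l" "(r, c) \<in> out_shape T" "(r, c) \<notin> in_shape T"
    "1 \<le> r" "r \<le> k" "1 \<le> c" "c \<le> n - k"
proof -
  show a: "1 \<le> l" "(r, c) \<in> out_shape T" "(r, c) \<notin> in_shape T"
    using assms well_formed_label_iff[OF assms(1), of "(r, c)"] by (auto simp: well_formed_def)
  show "1 \<le> r" "r \<le> k" "1 \<le> c" "c \<le> n - k" using well_formed_out[OF assms(1) a(2)] .
qed

lemma finite_edge_labels:
  assumes "well_formed k n T"
  shows "finite {(e, i). i \<in> elabels T e}"
proof -
  have "{(e, i). i \<in> elabels T e} = (SIGMA e : {0..k} \<times> {1..n-k}. elabels T e)"
    using well_formed_edge[OF assms] by fastforce
  then show ?thesis using assms by (auto simp: well_formed_def)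
qed

lemma occurs_column:
  "well_formed k n T \<Longrightarrow> occurs T c l \<Longrightarrow> 1 \<le> c \<and> c \<le> n - k \<and> 1 \<le> l"
  unfolding occurs_def using well_formed_label well_formed_edge by meson

lemma finite_occurs: "well_formed k n T \<Longrightarrow> finite {c'. c \<le> c' \<and> occurs T c' l}"
  by (rule finite_subset[of _ "{..n - k}"]) (auto dest: occurs_column)

text \<open>A strict column contains each label at most once, and not both in a box and on an edge.
  Counting occurrences thus becomes counting columns, which gives the recursion over columns used
  below.\<close>

lemma occ_from_eq:
  assumes wf: "well_formed k n T" and cs: "column_strict T"
  shows "occ_from T c l = card {c'. c \<le> c' \<and> occurs T c' l}"
proof -
  let ?B = "{(r, c'). c \<le> c' \<and> label T (r, c') = Some l}"
  let ?E = "{(e, c'). c \<le> c' \<and> l \<in> elabels T (e, c')}"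
  have "r = r'" if "label T (r, c') = Some l" "label T (r', c') = Some l" for r r' c'
    using column_strictD(1)[OF cs, of _ c' l _ l] that by (meson less_irrefl linorder_neqE_nat)
  then have "inj_on snd ?B" unfolding inj_on_def by auto
  then have B: "card (snd ` ?B) = card ?B" by (rule card_image)
  have "e = e'" if "l \<in> elabels T (e, c')" "l \<in> elabels T (e', c')" for e e' c'
    using column_strictD(4)[OF cs, of l _ c' l] that by (meson less_irrefl linorder_neqE_nat)
  then have "inj_on snd ?E" unfolding inj_on_def by auto
  then have E: "card (snd ` ?E) = card ?E" by (rule card_image)
  have "\<not> l \<in> elabels T (e, c')" if "label T (r, c') = Some l" for r e c'
    using column_strictD(2,3)[OF cs] that by (meson less_irrefl not_le)
  then have "snd ` ?B \<inter> snd ` ?E = {}" by auto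
  moreover have u: "snd ` ?B \<union> snd ` ?E = {c'. c \<le> c' \<and> occurs T c' l}"
    unfolding occurs_def image_def by auto
  moreover have "finite (snd ` ?B \<union> snd ` ?E)"
    unfolding u using finite_occurs[OF wf] .
  ultimately have "card {c'. c \<le> c' \<and> occurs T c' l} = card (snd ` ?B) + card (snd ` ?E)"
    by (simp only: finite_Un card_Un_disjoint flip: u)
  then show ?thesis using B E by (simp add: occ_from_def)
qed

lemma content_eq_occ_from: "content T i = occ_from T 0 i"
proof -
  have "{b. label T b = Some i} = {(r, c'). label T (r, c') = Some i}"
    "{e. i \<in> elabels T e} = {(e, c'). i \<in> elabels T (e, c')}" by auto
  then show ?thesis unfolding content_def occ_from_def by simp
qed

lemma occ_from_Suc:
  assumes wf: "well_formed k n T" and cs: "column_strict T"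
  shows "occ_from T c l = (if occurs T c l then 1 else 0) + occ_from T (c + 1) l"
proof -
  have "{c'. c \<le> c' \<and> occurs T c' l} =
      (if occurs T c l then insert c else id) {c'. c + 1 \<le> c' \<and> occurs T c' l}"
    by (auto simp: Suc_le_eq le_less)
  then show ?thesis
    unfolding occ_from_eq[OF assms] using finite_occurs[OF wf, of "c + 1" l] by simp
qed

lemma occ_from_pos:
  assumes wf: "well_formed k n T" and cs: "column_strict T"
  shows "0 < occ_from T c l \<longleftrightarrow> (\<exists>c' \<ge> c. occurs T c' l)"
  unfolding occ_from_eq[OF assms] using finite_occurs[OF wf, of c l] by (auto simp: card_gt_0_iff)

text \<open>Multiplicities depend only on which columns contain which labels. Vertical, expansion
  and resuscitation swaps move labels within their columns, so for them latticeness, content and the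
  factors of the weight need no further argument.\<close>

lemma occ_from_cong:
  assumes "well_formed k n T" "column_strict T" "well_formed k n T'" "column_strict T'"
    and "occurs T' = occurs T"
  shows "occ_from T' = occ_from T"
  by (intro ext) (simp add: occ_from_eq[OF assms(1,2)] occ_from_eq[OF assms(3,4)] assms(5))

lemma lattice_content_cong:
  assumes "occ_from T' = occ_from T"
  shows "lattice T' = lattice T" "content T' = content T"
  using assms by (auto simp: lattice_def content_eq_occ_from fun_eq_iff)

section \<open>Swaps preserve goodness\<close>

lemma column_strict_mono:
  assumes "column_strict T" "label T' \<subseteq>\<^sub>m label T" "\<And>e. elabels T' e \<subseteq> elabels T e"
  shows "column_strict T'"
proof -
  have "label T x = Some l" if "label T' x = Some l" for x l
    using assms(2) that by (metis domI map_le_def)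
  then show ?thesis
    unfolding column_strict_def using column_strictD[OF assms(1)] assms(3) by (meson subsetD)
qed

text \<open>A swap is decomposed into deletions, which cannot hurt, and insertions, each of which
  has to be compared only with the labels of its own column.\<close>

lemma column_strict_box:
  assumes cs: "column_strict T"
    and L: "label T' = (label T)((R, C) := Some m)" and E: "elabels T' = elabels T"
    and "\<And>r l. label T (r, C) = Some l \<Longrightarrow> r < R \<Longrightarrow> l < m"
    and "\<And>r l. label T (r, C) = Some l \<Longrightarrow> R < r \<Longrightarrow> m < l"
    and "\<And>e l. l \<in> elabels T (e, C) \<Longrightarrow> e < R \<Longrightarrow> l < m"
    and "\<And>e l. l \<in> elabels T (e, C) \<Longrightarrow> R \<le> e \<Longrightarrow> m < l"
  shows "column_strict T'"
  unfolding column_strict_def L E using assms(4-) column_strictD[OF cs]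
  by (auto split: if_splits)

lemma column_strict_edge:
  assumes cs: "column_strict T"
    and L: "label T' = label T" and E: "elabels T' = (elabels T)((R, C) := elabels T (R, C) \<union> S)"
    and "\<And>s r l. s \<in> S \<Longrightarrow> label T (r, C) = Some l \<Longrightarrow> r \<le> R \<Longrightarrow> l < s"
    and "\<And>s r l. s \<in> S \<Longrightarrow> label T (r, C) = Some l \<Longrightarrow> R < r \<Longrightarrow> s < l"
    and "\<And>s e l. s \<in> S \<Longrightarrow> l \<in> elabels T (e, C) \<Longrightarrow> e < R \<Longrightarrow> l < s"
    and "\<And>s e l. s \<in> S \<Longrightarrow> l \<in> elabels T (e, C) \<Longrightarrow> R < e \<Longrightarrow> s < l"
  shows "column_strict T'"
  unfolding column_strict_def L E using assms(4-) column_strictD[OF cs]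
  by (auto split: if_splits)

lemma row_weak_box:
  assumes "row_weak T" and "label T' = (label T)((R, C) := Some m)" and "C \<ge> 1"
    and "\<And>a. label T (R, C - 1) = Some a \<Longrightarrow> a \<le> m"
    and "\<And>s. label T (R, C + 1) = Some s \<Longrightarrow> m \<le> s"
  shows "row_weak T'"
  using assms unfolding row_weak_def by (auto split: if_splits)

lemma row_weak_mono:
  assumes "row_weak T" "label T' \<subseteq>\<^sub>m label T"
  shows "row_weak T'"
proof -
  have "label T x = Some l" if "label T' x = Some l" for x l
    using assms(2) that by (metis domI map_le_def)
  then show ?thesis using assms(1) unfolding row_weak_def by blast
qed

section \<open>The surroundings of the bullet\<close>

locale bulleted =
  fixes k n :: nat and mu :: "nat \<Rightarrow> nat" and T :: tableau and R C :: nat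
  assumes good: "good k n mu T" and bullet: "bullet T = Some (R, C)"
begin

lemma wf: "well_formed k n T" and cs: "column_strict T" and rw: "row_weak T"
  and lat: "lattice T" and ct: "content T = mu" and bok: "bullet_ok T"
  using good by (auto simp: good_def)

lemma young_in: "young_diagram (in_shape T)" and young_out: "young_diagram (out_shape T)"
  using wf by (auto simp: well_formed_def)

lemma bullet_out: "(R, C) \<in> out_shape T" and bullet_in: "(R, C) \<notin> in_shape T"
  using wf bullet by (auto simp: well_formed_def)

lemma R_C: "1 \<le> R" "R \<le> k" "1 \<le> C" "C \<le> n - k"
  using well_formed_out[OF wf bullet_out] .

lemma not_bullet_labelled:
  "(r, c) \<in> out_shape T \<Longrightarrow> (r, c) \<notin> in_shape T \<Longrightarrow> (r, c) \<noteq> (R, C) \<Longrightarrow> \<exists>l. label T (r, c) = Some l"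
  using well_formed_label_iff[OF wf, of "(r, c)"] bullet by auto

lemma bullet_unlabelled: "label T (R, C) = None"
  using well_formed_label_iff[OF wf, of "(R, C)"] bullet by (cases "label T (R, C)") auto

lemma not_in_right_down:
  "(r, c) \<notin> in_shape T \<Longrightarrow> 1 \<le> r \<Longrightarrow> 1 \<le> c \<Longrightarrow> r \<le> r' \<Longrightarrow> c \<le> c' \<Longrightarrow> (r', c') \<notin> in_shape T"
  using young_diagram_down[OF young_in] by blast

lemma southeast_labelled:
  assumes "(r, c) \<in> out_shape T" "R \<le> r" "C \<le> c" "(r, c) \<noteq> (R, C)"
  shows "\<exists>l. label T (r, c) = Some l"
  using not_bullet_labelled assms not_in_right_down[OF bullet_in] R_C by blast

text \<open>The two boxes are compared through \<open>(R + 1, C - 1)\<close>, which lies in the skew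
  shape: its label exceeds \<open>a\<close> down the column and is at most \<open>z\<close> along
  the row.\<close>

lemma left_below_less:
  assumes a: "label T (R, C - 1) = Some a" and z: "label T (R + 1, C) = Some z"
  shows "a < z"
proof -
  note p = well_formed_label[OF wf a] and q = well_formed_label[OF wf z]
  have "(R + 1, C - 1) \<in> out_shape T" using young_diagram_down[OF young_out q(2)] p by auto
  moreover have "(R + 1, C - 1) \<notin> in_shape T" using not_in_right_down[OF p(3)] p by auto
  ultimately obtain w where w: "label T (R + 1, C - 1) = Some w" using not_bullet_labelled by fastforce
  have "a < w" using column_strictD(1)[OF cs a w] by simp
  moreover have "w \<le> z" using rw w z p(6) unfolding row_weak_def
    by (metis le_add_diff_inverse2 diff_is_0_eq le_add_diff_inverse2 q(6))
  ultimately show ?thesis by simp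
qed

text \<open>So \<open>b_label\<close> is the least label of the column below the bullet: the minimum
  of the lower edge or, if that edge is empty, the label of the box below. That box exists as soon
  as any label lies further down, since columns of the shape have no gaps.\<close>

lemma below_b_label:
  assumes "(\<exists>r > R. label T (r, C) = Some l) \<or> (\<exists>e \<ge> R. l \<in> elabels T (e, C))"
  shows "\<exists>b. b_label T (R, C) = Some b \<and> b \<le> l"
proof (cases "elabels T (R, C) = {}")
  case False
  define b where "b = Min (elabels T (R, C))"
  have fin: "finite (elabels T (R, C))" using wf by (auto simp: well_formed_def)
  have b: "b \<in> elabels T (R, C)" using Min_in[OF fin False] by (simp add: b_def)
  have "b \<le> l" using assms
  proof
    assume "\<exists>r > R. label T (r, C) = Some l"
    then show ?thesis using column_strictD(3)[OF cs b] by (meson less_imp_le)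
  next
    assume "\<exists>e \<ge> R. l \<in> elabels T (e, C)"
    then obtain e where e: "e \<ge> R" "l \<in> elabels T (e, C)" by blast
    show ?thesis
    proof (cases "e = R")
      case True
      then show ?thesis using e fin by (simp add: b_def)
    next
      case False
      then show ?thesis using column_strictD(4)[OF cs b e(2)] e by simp
    qed
  qed
  then show ?thesis using False by (simp add: b_label_def lower_edge_def b_def)
next
  case True
  have "(R + 1, C) \<in> out_shape T" using assms
  proof
    assume "\<exists>r > R. label T (r, C) = Some l"
    then obtain r where r: "r > R" "label T (r, C) = Some l" by blast
    then show ?thesis using young_diagram_down[OF young_out well_formed_label(2)[OF wf r(2)]] R_C by auto
  next
    assume "\<exists>e \<ge> R. l \<in> elabels T (e, C)"
    then obtain e where e: "e \<ge> R" "l \<in> elabels T (e, C)" by blast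
    then have "e > R" using True by (cases "e = R") auto
    then show ?thesis using young_diagram_down[OF young_out, of e C] well_formed_edge(4)[OF wf e(2)] R_C by auto
  qed
  then obtain z where z: "label T (R + 1, C) = Some z" using southeast_labelled by fastforce
  have "z \<le> l" using assms
  proof
    assume "\<exists>r > R. label T (r, C) = Some l"
    then obtain r where r: "r > R" "label T (r, C) = Some l" by blast
    then show ?thesis using column_strictD(1)[OF cs z r(2)] z by (cases "r = R + 1") auto
  next
    assume "\<exists>e \<ge> R. l \<in> elabels T (e, C)"
    then obtain e where e: "e \<ge> R" "l \<in> elabels T (e, C)" by blast
    then have "e > R" using True by (cases "e = R") auto
    then show ?thesis using column_strictD(2)[OF cs z e(2)] by simp
  qed
  then show ?thesis using True z by (simp add: b_label_def lower_edge_def below_def)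
qed

text \<open>A box label above the bullet is at most its right neighbour, which lies above
  \<open>s\<close> in column \<open>C + 1\<close>. An edge label is compared first with the box
  directly above the bullet. The upper edge of the bullet itself is left out; it is controlled by
  \<open>bullet_ok\<close>.\<close>

lemma above_right_label:
  assumes s: "label T (R, C + 1) = Some s"
    and "(\<exists>r < R. label T (r, C) = Some l) \<or> (\<exists>e. e + 1 < R \<and> l \<in> elabels T (e, C))"
  shows "l < s"
proof -
  have *: "l < s" if r: "r < R" "label T (r, C) = Some l" for r l
  proof -
    note p = well_formed_label[OF wf r(2)] and q = well_formed_label[OF wf s]
    have "(r, C + 1) \<in> out_shape T" using young_diagram_down[OF young_out q(2)] p r by auto
    moreover have "(r, C + 1) \<notin> in_shape T" using not_in_right_down[OF p(3)] p by auto
    ultimately obtain w where w: "label T (r, C + 1) = Some w" using not_bullet_labelled by fastforce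
    have "l \<le> w" using rw r(2) w unfolding row_weak_def by blast
    also have "w < s" using column_strictD(1)[OF cs w s] r by simp
    finally show ?thesis .
  qed
  show ?thesis using assms(2)
  proof
    assume "\<exists>e. e + 1 < R \<and> l \<in> elabels T (e, C)"
    then obtain e where e: "e + 1 < R" "l \<in> elabels T (e, C)" by blast
    note p = well_formed_edge[OF wf e(2)]
    have "(R - 1, C) \<in> out_shape T" using young_diagram_down[OF young_out bullet_out] e R_C by auto
    moreover have "(R - 1, C) \<notin> in_shape T" using not_in_right_down[OF p(5)] p e by auto
    ultimately obtain w where w: "label T (R - 1, C) = Some w"
      using not_bullet_labelled[of "R - 1" C] e by fastforce
    have "l < w" using column_strictD(3)[OF cs e(2) w] e by simp
    also have "w < s" using *[OF _ w] e by simp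
    finally show ?thesis .
  qed (use * in blast)
qed

section \<open>Vertical swaps\<close>

lemma vertical_swap_good:
  assumes v: "goes_vertical T (R, C)" and E: "elabels T (R, C) = {}"
  shows "good k n mu (vertical_swap T (R, C)) \<and> occ_from (vertical_swap T (R, C)) = occ_from T"
proof -
  let ?T = "vertical_swap T (R, C)"
  obtain z where z: "label T (R + 1, C) = Some z" "\<And>s. label T (R, C + 1) = Some s \<Longrightarrow> z \<le> s"
    using v E by (auto simp: goes_vertical_def b_label_def r_label_def lower_edge_def below_def right_of_def)
  have L: "label ?T = (label T)((R, C) := Some z, (R + 1, C) := None)"
    using z by (simp add: vertical_swap_def below_def)
  have S: "in_shape ?T = in_shape T" "out_shape ?T = out_shape T" "elabels ?T = elabels T"
    "bullet ?T = Some (R + 1, C)"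
    by (simp_all add: vertical_swap_def below_def)
  note p = well_formed_label[OF wf z(1)]
  have wf': "well_formed k n ?T"
    using wf p bullet bullet_out bullet_in unfolding well_formed_def S L by auto
  let ?U = "T\<lparr>label := (label T)((R + 1, C) := None)\<rparr>"
  have L0: "label ?T = (label ?U)((R, C) := Some z)" by (auto simp: L)
  have cs0: "column_strict ?U" by (rule column_strict_mono[OF cs]) (auto simp: map_le_def)
  have cs': "column_strict ?T"
  proof (rule column_strict_box[OF cs0, of _ R C z])
    fix e l assume e: "l \<in> elabels ?U (e, C)" "R \<le> e"
    then have "R + 1 \<le> e" using E by (cases "e = R") auto
    then show "z < l" using column_strictD(2)[OF cs z(1)] e by simp
  qed (use L0 S in \<open>auto split: if_splits dest: column_strictD(1,3)[OF cs _ z(1)] column_strictD(1)[OF cs z(1)]\<close>)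
  have rw0: "row_weak ?U" by (rule row_weak_mono[OF rw]) (auto simp: map_le_def)
  have rw': "row_weak ?T"
    by (rule row_weak_box[OF rw0, of _ R C z])
      (use L0 z R_C left_below_less[OF _ z(1)] in \<open>auto split: if_splits simp: less_imp_le\<close>)
  have "occurs ?T = occurs T"
  proof (intro ext)
    show "occurs ?T c l = occurs T c l" for c l
    proof -
      have "\<exists>r'. label ?T (r', c) = Some l" if "label T (r, c) = Some l" for r
        using that z(1) bullet_unlabelled
        by (cases "(r, c) = (R + 1, C)") (auto simp: L intro: exI[of _ R] exI[of _ r])
      moreover have "\<exists>r'. label T (r', c) = Some l" if "label ?T (r, c) = Some l" for r
        using that z(1) by (auto simp: L split: if_splits)
      ultimately show ?thesis unfolding occurs_def S by blast
    qed
  qed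
  note oc = occ_from_cong[OF wf cs wf' cs' this]
  \<comment> \<open>The new bullet takes the place of \<open>z\<close>, which lies weakly between
    its row neighbours, so there is no descent across it. Its upper edge is the empty lower edge of
    the old bullet.\<close>
  have "bullet_ok ?T"
    unfolding bullet_ok_def S(4)
  proof (clarify, intro conjI allI impI ballI)
    fix a l assume a: "label ?T (R + 1, C - 1) = Some a" and l: "l \<in> elabels ?T (R + 1, C)"
    have a': "label T (R + 1, C - 1) = Some a" using a L by (auto split: if_splits)
    have "a \<le> z" using rw a' z(1) R_C unfolding row_weak_def by (metis le_add_diff_inverse2)
    also have "z < l" using column_strictD(2)[OF cs z(1)] l S by simp
    finally show "a \<le> l" by simp
  next
    fix s u assume "u \<in> elabels ?T (R + 1 - 1, C)"
    then show "u \<le> s" using E S by simp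
  next
    fix s a assume s: "label ?T (R + 1, C + 1) = Some s" and a: "label ?T (R + 1, C - 1) = Some a"
    have a': "label T (R + 1, C - 1) = Some a" using a L by (auto split: if_splits)
    have s': "label T (R + 1, C + 1) = Some s" using s L by (auto split: if_splits)
    have "a \<le> z" using rw a' z(1) R_C unfolding row_weak_def by (metis le_add_diff_inverse2)
    also have "z \<le> s" using rw s' z(1) unfolding row_weak_def by blast
    finally show "a \<le> s \<or> s \<notin> elabels ?T (R + 1 - 1, C) \<and> {s + 1..a} \<subseteq> elabels ?T (R + 1, C + 1) \<and>
         (\<forall>l. s \<le> l \<and> l \<le> a \<longrightarrow> occ_from ?T (C + 1) l = occ_from ?T (C + 1) s) \<and>
         (\<forall>l \<in> elabels ?T (R + 1, C). a < l)" by simp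
  qed
  then show ?thesis
    using wf' cs' rw' lattice_content_cong[OF oc] lat ct oc by (simp add: good_def)
qed

end

section \<open>Expansion swaps\<close>

definition expand_box :: "tableau \<Rightarrow> box \<Rightarrow> tableau" where
  "expand_box T x = T\<lparr>label := (label T)(x := Some (Min (elabels T x))),
     elabels := (elabels T)(x := elabels T x - {Min (elabels T x)}), bullet := None\<rparr>"

definition expand_edge :: "tableau \<Rightarrow> box \<Rightarrow> tableau" where
  "expand_edge T x = (let E = (elabels T)(x := elabels T x - {Min (elabels T x)})
     in T\<lparr>elabels := E(upper_edge x := insert (Min (elabels T x)) (E (upper_edge x)))\<rparr>)"

lemma expansion_swap_eq:
  "expansion_swap k T x =
     Poly_Mapping.single (expand_box T x) (beta k x) + Poly_Mapping.single (expand_edge T x) 1"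
  by (simp add: expansion_swap_def expand_box_def expand_edge_def Let_def lower_edge_def)

context bulleted
begin

lemma finite_elabels: "finite (elabels T e)"
  using wf unfolding well_formed_def by blast

lemma bullet_okD:
  shows "label T (R, C - 1) = Some a \<Longrightarrow> l \<in> elabels T (R, C) \<Longrightarrow> a \<le> l"
    and "label T (R, C + 1) = Some s \<Longrightarrow> u \<in> elabels T (R - 1, C) \<Longrightarrow> u \<le> s"
    and "label T (R, C + 1) = Some s \<Longrightarrow> label T (R, C - 1) = Some a \<Longrightarrow>
       a \<le> s \<or> s \<notin> elabels T (R - 1, C) \<and> {s + 1..a} \<subseteq> elabels T (R, C + 1) \<and>
           (\<forall>l. s \<le> l \<and> l \<le> a \<longrightarrow> occ_from T (C + 1) l = occ_from T (C + 1) s) \<and>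
           (\<forall>l \<in> elabels T (R, C). a < l)"
  using bok bullet unfolding bullet_ok_def by blast+

context
  fixes b
  assumes v: "goes_vertical T (R, C)" and E: "elabels T (R, C) \<noteq> {}"
    and b_def: "b = Min (elabels T (R, C))"
begin

lemma expansion_label:
  shows "b \<in> elabels T (R, C)" and "l \<in> elabels T (R, C) \<Longrightarrow> b \<le> l"
    and "label T (R, C + 1) = Some s \<Longrightarrow> b \<le> s"
  using v E finite_elabels[of "(R, C)"]
  by (auto simp: b_def goes_vertical_def b_label_def r_label_def lower_edge_def right_of_def)

lemma remove_expansion_label:
  "column_strict (T\<lparr>elabels := (elabels T)((R, C) := elabels T (R, C) - {b})\<rparr>)"
  by (auto intro!: column_strict_mono[OF cs] split: if_splits)

text \<open>The bullet disappears, so the row has to be weak at \<open>b\<close>: the left label is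
  at most \<open>b\<close> by the first clause of \<open>bullet_ok\<close>, and the right label is
  at least \<open>b\<close> because the move is vertical.\<close>

lemma expand_box_good: "good k n mu (expand_box T (R, C)) \<and> occ_from (expand_box T (R, C)) = occ_from T"
proof -
  let ?T = "expand_box T (R, C)"
  let ?U = "T\<lparr>elabels := (elabels T)((R, C) := elabels T (R, C) - {b})\<rparr>"
  note b = expansion_label
  note D = column_strictD[OF cs]
  have L: "label ?T = (label T)((R, C) := Some b)"
    and F: "elabels ?T = (elabels T)((R, C) := elabels T (R, C) - {b})"
    by (simp_all add: expand_box_def b_def)
  have S: "in_shape ?T = in_shape T" "out_shape ?T = out_shape T" "bullet ?T = None"
    by (simp_all add: expand_box_def)
  note p = well_formed_edge[OF wf b(1)]
  have wf': "well_formed k n ?T"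
    using wf p bullet bullet_out bullet_in unfolding well_formed_def S L F
    by (auto split: if_splits)
  have cs': "column_strict ?T"
  proof (rule column_strict_box[OF remove_expansion_label, of _ R C b])
    fix e l assume e: "l \<in> elabels ?U (e, C)" "R \<le> e"
    then show "b < l" using b(2)[of l] D(4)[OF b(1), of l e] by (cases "e = R") auto
  qed (use L F D(3)[OF b(1)] D(2)[OF _ b(1)] D(4)[OF _ b(1)] in \<open>auto split: if_splits\<close>)
  have rw': "row_weak ?T"
    by (rule row_weak_box[OF rw L]) (use R_C bullet_okD(1) b in auto)
  have "occurs ?T = occurs T"
  proof (intro ext iffI)
    fix c l assume "occurs ?T c l"
    then show "occurs T c l" using b(1) unfolding occurs_def L F by (auto split: if_splits)
  next
    fix c l assume "occurs T c l"
    then consider r where "label T (r, c) = Some l" | e where "l \<in> elabels T (e, c)"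
      unfolding occurs_def by blast
    then show "occurs ?T c l"
    proof cases
      case 1
      then show ?thesis using bullet_unlabelled unfolding occurs_def L
        by (intro disjI1 exI[of _ r]) auto
    next
      case 2
      then show ?thesis unfolding occurs_def L F
        by (cases "(e, c) = (R, C) \<and> l = b") (auto intro: exI[of _ R] exI[of _ e])
    qed
  qed
  note oc = occ_from_cong[OF wf cs wf' cs' this]
  show ?thesis
    using wf' cs' rw' lattice_content_cong[OF oc] lat ct S oc by (simp add: good_def bullet_ok_def)
qed

lemma expand_edge_good: "good k n mu (expand_edge T (R, C)) \<and> occ_from (expand_edge T (R, C)) = occ_from T"
proof -
  let ?T = "expand_edge T (R, C)"
  let ?U = "T\<lparr>elabels := (elabels T)((R, C) := elabels T (R, C) - {b})\<rparr>"
  note b = expansion_label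
  note D = column_strictD[OF cs]
  have F: "elabels ?T = (elabels ?U)((R - 1, C) := elabels ?U (R - 1, C) \<union> {b})"
    by (simp add: expand_edge_def b_def upper_edge_def Let_def)
  have F': "elabels ?T e = (if e = (R, C) then elabels T e - {b} else
      if e = (R - 1, C) then insert b (elabels T e) else elabels T e)" for e
    using R_C by (auto simp: F)
  have S: "in_shape ?T = in_shape T" "out_shape ?T = out_shape T" "bullet ?T = bullet T"
    "label ?T = label T"
    by (simp_all add: expand_edge_def Let_def)
  note p = well_formed_edge[OF wf b(1)]
  have "R - 1 = 0 \<or> (R - 1, C) \<in> out_shape T"
    using young_diagram_down[OF young_out bullet_out, of "R - 1" C] R_C by (cases "R - 1 = 0") auto
  then have wf': "well_formed k n ?T"
    using wf p bullet_in R_C unfolding well_formed_def S by (auto simp: F' split: if_splits)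
  have cs': "column_strict ?T"
  proof (rule column_strict_edge[OF remove_expansion_label _ F])
    fix s e l assume e: "s \<in> {b}" "l \<in> elabels ?U (e, C)" "R - 1 < e"
    then show "s < l" using b(2)[of l] D(4)[OF b(1), of l e] by (cases "e = R") auto
  next
    fix s r l assume "s \<in> {b}" "label ?U (r, C) = Some l" "R - 1 < r"
    then show "s < l" using D(3)[OF b(1), of r l] bullet_unlabelled by (cases "r = R") auto
  qed (use S D(2)[OF _ b(1)] D(4)[OF _ b(1)] R_C in \<open>auto split: if_splits\<close>)
  have "row_weak ?T" using rw by (simp add: row_weak_def S)
  moreover have "occurs ?T = occurs T"
  proof -
    have "(\<exists>e. l \<in> elabels ?T (e, c)) \<longleftrightarrow> (\<exists>e. l \<in> elabels T (e, c))" for c l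
    proof
      assume "\<exists>e. l \<in> elabels T (e, c)"
      then obtain e where "l \<in> elabels T (e, c)" by blast
      then show "\<exists>e. l \<in> elabels ?T (e, c)"
        using R_C by (cases "(e, c) = (R, C) \<and> l = b") (auto simp: F' intro: exI[of _ "R - 1"] exI[of _ e])
    qed (use b(1) in \<open>auto simp: F' split: if_splits\<close>)
    then show ?thesis by (simp add: fun_eq_iff occurs_def S)
  qed
  note oc = occ_from_cong[OF wf cs wf' cs' this]
  have "bullet_ok ?T"
    unfolding bullet_ok_def S bullet
  proof (clarify, intro conjI allI impI ballI)
    fix a l assume "label T (R, C - 1) = Some a" and "l \<in> elabels ?T (R, C)"
    then show "a \<le> l" using bullet_okD(1) by (simp add: F')
  next
    fix s u assume "label T (R, C + 1) = Some s" "u \<in> elabels ?T (R - 1, C)"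
    then show "u \<le> s" using bullet_okD(2) b(3) R_C by (auto simp: F' split: if_splits)
  next
    fix s a assume s: "label T (R, C + 1) = Some s" and a: "label T (R, C - 1) = Some a"
    \<comment> \<open>In the descending alternative of \<open>bullet_ok\<close> every label on the
      lower edge exceeds \<open>a\<close>, hence \<open>b\<close> would exceed \<open>s\<close>,
      whereas a vertical move has \<open>b \<le> s\<close>.\<close>
    then have "a \<le> s" using bullet_okD(3)[OF s a] b(1) b(3)[OF s] by auto
    then show "a \<le> s \<or> s \<notin> elabels ?T (R - 1, C) \<and> {s + 1..a} \<subseteq> elabels ?T (R, C + 1) \<and>
         (\<forall>l. s \<le> l \<and> l \<le> a \<longrightarrow> occ_from ?T (C + 1) l = occ_from ?T (C + 1) s) \<and>
         (\<forall>l \<in> elabels ?T (R, C). a < l)" by simp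
  qed
  ultimately show ?thesis
    using wf' cs' lattice_content_cong[OF oc] lat ct oc by (simp add: good_def)
qed

end

section \<open>Resuscitation swaps\<close>

context
  fixes s
  assumes h: "goes_horizontal T (R, C)" and s: "label T (R, C + 1) = Some s"
begin

lemma horizontal_less: "b_label T (R, C) = Some b \<Longrightarrow> s < b"
  using h s by (auto simp: goes_horizontal_def r_label_def right_of_def)

lemma horizontal_below:
  assumes "(\<exists>r > R. label T (r, C) = Some l) \<or> (\<exists>e \<ge> R. l \<in> elabels T (e, C))"
  shows "s < l"
  using below_b_label[OF assms] horizontal_less by fastforce

text \<open>The two copies of \<open>s\<close>, on the upper edge of the bullet and in the box to
  its right, each move within their own column. As \<open>s\<close> lies on that upper edge, the
  descending alternative of \<open>bullet_ok\<close> is excluded, and \<open>s\<close> fits next to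
  the left label.\<close>

lemma resuscitation_swap_good:
  assumes u: "s \<in> elabels T (R - 1, C)"
  shows "good k n mu (resuscitation_swap T (R, C)) \<and> occ_from (resuscitation_swap T (R, C)) = occ_from T"
proof -
  let ?T = "resuscitation_swap T (R, C)"
  note D = column_strictD[OF cs]
  have Max: "Max (elabels T (R - 1, C)) = s"
    using u bullet_okD(2)[OF s] finite_elabels by (intro Max_eqI)
  have S: "in_shape ?T = in_shape T" "out_shape ?T = out_shape T" "bullet ?T = Some (R, C + 1)"
    and L: "label ?T = (label T)((R, C) := Some s, (R, C + 1) := None)"
    and F: "elabels ?T = (elabels T)((R - 1, C) := elabels T (R - 1, C) - {s},
       (R, C + 1) := elabels T (R, C + 1) \<union> {s})"
    using Max s
    by (simp_all add: resuscitation_swap_def right_of_def upper_edge_def lower_edge_def Let_def r_label_def)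
  note p = well_formed_label[OF wf s]
  have wf': "well_formed k n ?T"
    using wf p bullet bullet_out bullet_in not_in_right_down[OF bullet_in R_C(1,3), of "R + 1" "C + 1"]
      well_formed_edge(4)[OF wf, of _ "R - 1" C]
    unfolding well_formed_def S L F by (auto split: if_splits)
  let ?U = "T\<lparr>label := (label T)((R, C + 1) := None),
    elabels := (elabels T)((R - 1, C) := elabels T (R - 1, C) - {s})\<rparr>"
  let ?V = "?U\<lparr>label := (label ?U)((R, C) := Some s)\<rparr>"
  have csU: "column_strict ?U"
    by (rule column_strict_mono[OF cs]) (auto simp: map_le_def)
  have LV: "label ?V = (label ?U)((R, C) := Some s)" "elabels ?V = elabels ?U" by simp_all
  have csV: "column_strict ?V"
  proof (rule column_strict_box[OF csU LV])
    fix r l assume "label ?U (r, C) = Some l" "r < R"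
    then show "l < s" using above_right_label[OF s] by (auto split: if_splits)
  next
    fix r l assume "label ?U (r, C) = Some l" "R < r"
    then show "s < l" using horizontal_below by (auto split: if_splits)
  next
    fix e l assume e: "l \<in> elabels ?U (e, C)" "e < R"
    show "l < s"
    proof (cases "e = R - 1")
      case True
      then show ?thesis using e bullet_okD(2)[OF s, of l] by auto
    next
      case False
      then have "e + 1 < R" "l \<in> elabels T (e, C)" using e by (auto split: if_splits)
      then show ?thesis using above_right_label[OF s, of l] by blast
    qed
  next
    fix e l assume "l \<in> elabels ?U (e, C)" "R \<le> e"
    then have "R \<le> e \<and> l \<in> elabels T (e, C)" by (auto split: if_splits)
    then show "s < l" using horizontal_below by blast
  qed
  have L2: "label ?T = label ?V"
    "elabels ?T = (elabels ?V)((R, C + 1) := elabels ?V (R, C + 1) \<union> {s})"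
    by (auto simp: L F)
  have cs': "column_strict ?T"
  proof (rule column_strict_edge[OF csV L2])
    fix s' r l assume "s' \<in> {s}" "label ?V (r, C + 1) = Some l" "r \<le> R"
    then show "l < s'" using D(1)[OF _ s, of r l] by (cases "r = R") auto
  next
    fix s' e l assume "s' \<in> {s}" "l \<in> elabels ?V (e, C + 1)" "R < e"
    then show "s' < l" using D(2)[OF s, of l e] by auto
  qed (use D(1)[OF s] D(3)[OF _ s] in auto)
  let ?W = "T\<lparr>label := (label T)((R, C + 1) := None)\<rparr>"
  have rwW: "row_weak ?W" by (rule row_weak_mono[OF rw]) (auto simp: map_le_def)
  have LW: "label ?T = (label ?W)((R, C) := Some s)" by (auto simp: L)
  have rw': "row_weak ?T"
    by (rule row_weak_box[OF rwW LW]) (use R_C bullet_okD(3)[OF s] u in \<open>auto split: if_splits\<close>)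
  have "occurs ?T = occurs T"
  proof (intro ext iffI)
    fix c l assume "occurs ?T c l"
    then show "occurs T c l" using u s unfolding occurs_def L F by (auto split: if_splits)
  next
    fix c l assume "occurs T c l"
    then consider r where "label T (r, c) = Some l" | e where "l \<in> elabels T (e, c)"
      unfolding occurs_def by blast
    then show "occurs ?T c l"
    proof cases
      case 1
      then show ?thesis using bullet_unlabelled s unfolding occurs_def L F
        by (cases "(r, c) = (R, C + 1)") (auto intro: exI[of _ R] exI[of _ r])
    next
      case 2
      then show ?thesis unfolding occurs_def L F
        by (cases "(e, c) = (R - 1, C) \<and> l = s") (auto intro: exI[of _ R] exI[of _ e])
    qed
  qed
  note oc = occ_from_cong[OF wf cs wf' cs' this]
  have "bullet_ok ?T"
    unfolding bullet_ok_def S(3)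
  proof (clarify, intro conjI allI impI ballI)
    \<comment> \<open>Equality occurs for the copy of \<open>s\<close> just placed on this edge;
      therefore the first clause of \<open>bullet_ok\<close> can only be a weak inequality.\<close>
    fix a l assume "label ?T (R, C + 1 - 1) = Some a" and l: "l \<in> elabels ?T (R, C + 1)"
    then have "a = s" by (simp add: L)
    then show "a \<le> l" using D(2)[OF s, of l R] l by (auto simp: F)
  next
    fix t u assume t: "label ?T (R, C + 1 + 1) = Some t" and u: "u \<in> elabels ?T (R - 1, C + 1)"
    have "s \<le> t" using rw s t unfolding row_weak_def by (auto simp: L)
    moreover have "u < s" using D(3)[OF _ s, of u "R - 1"] u R_C by (auto simp: F split: if_splits)
    ultimately show "u \<le> t" by simp
  next
    fix t a assume t: "label ?T (R, C + 1 + 1) = Some t" and a: "label ?T (R, C + 1 - 1) = Some a"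
    have "s \<le> t" using rw s t unfolding row_weak_def by (auto simp: L)
    then have "a \<le> t" using a by (simp add: L)
    then show "a \<le> t \<or> t \<notin> elabels ?T (R - 1, C + 1) \<and> {t + 1..a} \<subseteq> elabels ?T (R, C + 1 + 1) \<and>
         (\<forall>l. t \<le> l \<and> l \<le> a \<longrightarrow> occ_from ?T (C + 1 + 1) l = occ_from ?T (C + 1 + 1) t) \<and>
         (\<forall>l \<in> elabels ?T (R, C + 1). a < l)" by simp
  qed
  then show ?thesis
    using wf' cs' rw' lattice_content_cong[OF oc] lat ct oc by (simp add: good_def)
qed

end

end

section \<open>Horizontal swaps\<close>

locale bulleted_horizontal = bulleted +
  fixes s m :: nat
  assumes h: "goes_horizontal T (R, C)" and s: "label T (R, C + 1) = Some s"
    and not_u: "s \<notin> elabels T (R - 1, C)"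
    and m_def: "m = horizontal_m T (R, C)"
begin

text \<open>The candidates for the label moved into the box of the bullet. Values below
  \<open>s\<close> can qualify too, as the conditions on intervals starting at \<open>s\<close> are
  then void.\<close>

definition admissible :: "nat set" where
  "admissible = {m. (\<forall>b. b_label T (R, C) = Some b \<longrightarrow> m < b) \<and>
     (\<forall>l. label T (R, C - 1) = Some l \<longrightarrow> l \<le> m) \<and>
     (\<forall>l. s \<le> l \<and> l \<le> m \<longrightarrow> occ_from T (C + 1) l = occ_from T (C + 1) s) \<and>
     {s + 1..m} \<subseteq> elabels T (R, C + 1)}"

lemma m_eq: "m = Max admissible"
  using s by (simp add: m_def horizontal_m_def admissible_def Let_def right_of_def left_of_def
      lower_edge_def r_label_def)

lemma finite_admissible: "finite admissible"
proof (rule finite_subset)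
  show "admissible \<subseteq> {..s} \<union> elabels T (R, C + 1)"
    unfolding admissible_def by (auto simp: subset_eq not_le)
  show "finite ({..s} \<union> elabels T (R, C + 1))" using finite_elabels by simp
qed

lemma left_less_b_label:
  assumes a: "label T (R, C - 1) = Some a" "s < a" and b: "b_label T (R, C) = Some b"
  shows "a < b"
proof (cases "elabels T (R, C) = {}")
  case True
  then show ?thesis using b left_below_less[OF a(1)]
    by (simp add: b_label_def lower_edge_def below_def)
next
  case False
  then have "b \<in> elabels T (R, C)" using b Min_in[OF finite_elabels False]
    by (simp add: b_label_def lower_edge_def)
  then show ?thesis using bullet_okD(3)[OF s a(1)] a by auto
qed

text \<open>If the row descends from \<open>a\<close> to \<open>s\<close>, then
  \<open>bullet_ok\<close> together with \<open>left_less_b_label\<close> makes \<open>a\<close> a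
  candidate; otherwise \<open>s\<close> is one. This is where a descent left by an earlier
  horizontal swap is repaired: the label chosen now is at least \<open>a\<close>.\<close>

lemma admissible_ge: "\<exists>m0 \<in> admissible. s \<le> m0"
proof (cases "\<exists>a. label T (R, C - 1) = Some a \<and> s < a")
  case True
  then obtain a where a: "label T (R, C - 1) = Some a" "s < a" by blast
  then have "{s + 1..a} \<subseteq> elabels T (R, C + 1)"
    "\<forall>l. s \<le> l \<and> l \<le> a \<longrightarrow> occ_from T (C + 1) l = occ_from T (C + 1) s"
    using bullet_okD(3)[OF s a(1)] by (meson not_le)+
  then have "a \<in> admissible"
    using a left_less_b_label[OF a] unfolding admissible_def mem_Collect_eq
    by (intro conjI) (blast | simp)+
  then show ?thesis using a by (auto intro: less_imp_le)
next
  case False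
  then have "s \<in> admissible"
    using horizontal_less[OF h s] unfolding admissible_def by (auto simp: not_less)
  then show ?thesis by blast
qed

lemma s_le_m: "s \<le> m" and m_admissible: "m \<in> admissible"
  and m_Max: "m' \<in> admissible \<Longrightarrow> m' \<le> m"
proof -
  show "m \<in> admissible" unfolding m_eq using finite_admissible admissible_ge by (intro Max_in) auto
  show *: "m' \<in> admissible \<Longrightarrow> m' \<le> m" for m' unfolding m_eq using finite_admissible by simp
  show "s \<le> m" using admissible_ge * by fastforce
qed

lemma m_props:
  shows "b_label T (R, C) = Some b \<Longrightarrow> m < b"
    and "label T (R, C - 1) = Some a \<Longrightarrow> a \<le> m"
    and "s \<le> l \<Longrightarrow> l \<le> m \<Longrightarrow> occ_from T (C + 1) l = occ_from T (C + 1) s"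
    and "s < l \<Longrightarrow> l \<le> m \<Longrightarrow> l \<in> elabels T (R, C + 1)"
  using m_admissible unfolding admissible_def mem_Collect_eq subset_eq by (blast | simp)+

text \<open>On the upper edge of the bullet \<open>bullet_ok\<close> gives only a weak inequality;
  \<open>not_u\<close> makes it strict. Together with \<open>column_below\<close> this shows that
  column \<open>C\<close> has a gap from \<open>s\<close> to \<open>m\<close>, into which the labels
  of column \<open>C + 1\<close> can move.\<close>

lemma column_above:
  assumes "(\<exists>r < R. label T (r, C) = Some l) \<or> (\<exists>e < R. l \<in> elabels T (e, C))"
  shows "l < s"
proof -
  consider "(\<exists>r < R. label T (r, C) = Some l) \<or> (\<exists>e. e + 1 < R \<and> l \<in> elabels T (e, C))"
    | "l \<in> elabels T (R - 1, C)"
  proof -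
    have "e + 1 < R \<or> e = R - 1" if "e < R" for e using that by auto
    then show ?thesis using assms that by metis
  qed
  then show ?thesis
  proof cases
    case 2
    then show ?thesis using bullet_okD(2)[OF s] not_u by (metis le_neq_implies_less)
  qed (use above_right_label[OF s] in blast)
qed

lemma column_below:
  assumes "(\<exists>r > R. label T (r, C) = Some l) \<or> (\<exists>e \<ge> R. l \<in> elabels T (e, C))"
  shows "m < l"
  using below_b_label[OF assms] m_props(1) by fastforce

lemma not_occurs_C: "s \<le> l \<Longrightarrow> l \<le> m \<Longrightarrow> \<not> occurs T C l"
  unfolding occurs_def using column_above[of l] column_below[of l] bullet_unlabelled
  by (metis linorder_neqE_nat not_le option.distinct(1))

lemma occurs_Suc_C: "s \<le> l \<Longrightarrow> l \<le> m \<Longrightarrow> occurs T (C + 1) l"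
  unfolding occurs_def using s m_props(4)[of l] by (metis le_neq_implies_less)

text \<open>A label below row \<open>R\<close> in column \<open>c\<close> forces row
  \<open>R + 1\<close> to be filled from column \<open>C\<close> to \<open>c\<close>. The label is
  at least that of \<open>(R + 1, c)\<close>, and labels weakly decrease on the way left to columns
  \<open>C + 1\<close> and \<open>C\<close>.\<close>

lemma below_right_greater:
  assumes "c > C" "(\<exists>r > R. label T (r, c) = Some l) \<or> (\<exists>e > R. l \<in> elabels T (e, c))"
  shows "\<exists>b. b_label T (R, C) = Some b \<and> b \<le> l" "\<exists>w. label T (R + 1, C + 1) = Some w \<and> w \<le> l"
proof -
  have out: "(R + 1, c) \<in> out_shape T" using assms(2)
  proof
    assume "\<exists>r > R. label T (r, c) = Some l"
    then obtain r where r: "r > R" "label T (r, c) = Some l" by blast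
    note p = well_formed_label[OF wf r(2)]
    show ?thesis using young_diagram_down[OF young_out p(2)] p r by auto
  next
    assume "\<exists>e > R. l \<in> elabels T (e, c)"
    then obtain e where e: "e > R" "l \<in> elabels T (e, c)" by blast
    note p = well_formed_edge[OF wf e(2)]
    show ?thesis using young_diagram_down[OF young_out, of e c] p e by auto
  qed
  have lab: "\<exists>w. label T (R + 1, c') = Some w" if "C \<le> c'" "c' \<le> c" for c'
    using southeast_labelled[of "R + 1" c'] young_diagram_down[OF young_out out, of "R + 1" c'] that R_C
    by auto
  obtain w where w: "label T (R + 1, c) = Some w" using lab[of c] assms by auto
  have "w \<le> l" using assms(2)
  proof
    assume "\<exists>r > R. label T (r, c) = Some l"
    then obtain r where r: "r > R" "label T (r, c) = Some l" by blast
    then show ?thesis using column_strictD(1)[OF cs w r(2)] w by (cases "r = R + 1") auto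
  next
    assume "\<exists>e > R. l \<in> elabels T (e, c)"
    then show ?thesis using column_strictD(2)[OF cs w] by fastforce
  qed
  moreover have row: "\<exists>v. label T (R + 1, c') = Some v \<and> v \<le> w" if "C \<le> c'" "c' \<le> c" for c'
    using that(2) that(1)
  proof (induction rule: inc_induct)
    case base
    then show ?case using w by simp
  next
    case (step c')
    then obtain v where v: "label T (R + 1, Suc c') = Some v" "v \<le> w" by auto
    obtain v' where v': "label T (R + 1, c') = Some v'" using lab[of c'] step by auto
    then have "v' \<le> v" using rw v unfolding row_weak_def by simp
    then show ?case using v v' by auto
  qed
  ultimately show "\<exists>w. label T (R + 1, C + 1) = Some w \<and> w \<le> l"
    using row[of "C + 1"] assms(1) by fastforce
  obtain z where z: "label T (R + 1, C) = Some z" "z \<le> l"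
    using row[of C] assms(1) \<open>w \<le> l\<close> by fastforce
  then show "\<exists>b. b_label T (R, C) = Some b \<and> b \<le> l"
    using below_b_label[of z] by fastforce
qed

text \<open>Column \<open>C + 1\<close> is about to lose its \<open>m\<close>, so a surplus over
  \<open>m + 1\<close> must exist beforehand. With equal counts, \<open>m + 1\<close> could occur in
  column \<open>C + 1\<close> only on the lower edge of the box to be vacated, where it would be a
  larger candidate. If it does not occur there, column \<open>C + 1\<close> has an \<open>m\<close>
  without an \<open>m + 1\<close>, and latticeness fails at \<open>C + 2\<close>.\<close>

lemma Suc_m_fewer: "occ_from T (C + 1) (m + 1) < occ_from T (C + 1) m"
proof (rule ccontr)
  have s1: "1 \<le> s" using well_formed_label[OF wf s] by simp
  have lat': "occ_from T c (m + 1) \<le> occ_from T c m" if "c \<ge> 1" for c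
    using lat that s1 s_le_m unfolding lattice_def by auto
  assume "\<not> ?thesis"
  then have eq: "occ_from T (C + 1) (m + 1) = occ_from T (C + 1) m" using lat'[of "C + 1"] by simp
  \<comment> \<open>Otherwise column \<open>C\<close> would contain \<open>m + 1\<close> but not
    \<open>m\<close>, and with equal counts from \<open>C + 1\<close> on latticeness would fail at
    \<open>C\<close>.\<close>
  have b: "b_label T (R, C) \<noteq> Some (m + 1)"
  proof
    assume "b_label T (R, C) = Some (m + 1)"
    then have "occurs T C (m + 1)"
      using Min_in[OF finite_elabels, of "(R, C)"] unfolding occurs_def b_label_def
      by (auto simp: lower_edge_def below_def split: if_splits)
    then show False
      using lat'[OF R_C(3)] occ_from_Suc[OF wf cs, of C "m + 1"] occ_from_Suc[OF wf cs, of C m]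
        not_occurs_C[OF s_le_m] eq by simp
  qed
  have notin: "m + 1 \<notin> elabels T (R, C + 1)"
  proof
    assume 1: "m + 1 \<in> elabels T (R, C + 1)"
    have "m + 1 \<in> admissible" unfolding admissible_def
    proof (safe)
      fix b' assume "b_label T (R, C) = Some b'"
      then show "m + 1 < b'" using b m_props(1)[of b'] by (cases "b' = m + 1") auto
    next
      fix l assume "label T (R, C - 1) = Some l"
      then show "l \<le> m + 1" using m_props(2) by fastforce
    next
      fix l assume "s \<le> l" "l \<le> m + 1"
      then show "occ_from T (C + 1) l = occ_from T (C + 1) s"
        using m_props(3)[of l] m_props(3)[of m] eq s_le_m by (cases "l = m + 1") auto
    next
      fix l assume "l \<in> {s + 1..m + 1}"
      then show "l \<in> elabels T (R, C + 1)" using 1 m_props(4)[of l] by (cases "l = m + 1") auto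
    qed
    then show False using m_Max by fastforce
  qed
  have nb: False if "(\<exists>r > R. label T (r, C + 1) = Some (m + 1)) \<or> (\<exists>e > R. m + 1 \<in> elabels T (e, C + 1))"
    using below_right_greater(1)[OF _ that] m_props(1) b by (metis le_antisym less_add_one Suc_eq_plus1 Suc_leI)
  have "\<not> occurs T (C + 1) (m + 1)"
  proof
    assume "occurs T (C + 1) (m + 1)"
    then consider r where "label T (r, C + 1) = Some (m + 1)" | e where "m + 1 \<in> elabels T (e, C + 1)"
      unfolding occurs_def by blast
    then show False
    proof cases
      case 1
      then show ?thesis using column_strictD(1)[OF cs 1 s] nb s s_le_m
        by (cases r R rule: linorder_cases) auto
    next
      case 2
      then show ?thesis using column_strictD(3)[OF cs 2 s] nb notin s_le_m
        by (cases e R rule: linorder_cases) auto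
    qed
  qed
  then show False
    using lat'[of "C + 2"] occ_from_Suc[OF wf cs, of "C + 1" "m + 1"] occ_from_Suc[OF wf cs, of "C + 1" m]
      occurs_Suc_C[OF s_le_m] eq by simp
qed

text \<open>Prepares the descending alternative of \<open>bullet_ok\<close> for the new bullet. The
  labels from \<open>s\<close> to \<open>m\<close> have equal counts from \<open>C + 1\<close> and
  all occur in that column, so their counts from \<open>C + 2\<close> agree as well. Latticeness at
  \<open>C + 3\<close> then propagates occurrence in column \<open>C + 2\<close> upwards from
  \<open>t\<close> to \<open>m\<close>. A label exceeding \<open>t\<close> is not above row
  \<open>R\<close>, and it is not further below, since \<open>(R + 1, C + 1)\<close> lies under an
  edge carrying \<open>m\<close>; the lower edge of row \<open>R\<close> remains.\<close>

lemma next_column: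
  assumes t: "label T (R, C + 2) = Some t" and l: "t < l" "l \<le> m"
  shows "l \<in> elabels T (R, C + 2)"
proof -
  have s1: "1 \<le> s" using well_formed_label[OF wf s] by simp
  have st: "s \<le> t" using rw s t unfolding row_weak_def by auto
  have const: "occ_from T (C + 2) l = occ_from T (C + 2) s" if "s \<le> l" "l \<le> m" for l
    using occ_from_Suc[OF wf cs, of "C + 1" l] occ_from_Suc[OF wf cs, of "C + 1" s] that s_le_m
      m_props(3)[OF that] occurs_Suc_C[OF that] occurs_Suc_C[of s] by simp
  have oc: "l \<le> m \<longrightarrow> occurs T (C + 2) l" if "t \<le> l" for l
    using that
  proof (induction rule: dec_induct)
    case base
    then show ?case using t unfolding occurs_def by blast
  next
    case (step l)
    show ?case
    proof
      assume le: "Suc l \<le> m"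
      have "occ_from T (C + 3) (l + 1) \<le> occ_from T (C + 3) l"
        using lat step(1) st s1 unfolding lattice_def by auto
      then show "occurs T (C + 2) (Suc l)"
        using step const[of l] const[of "Suc l"] le st
          occ_from_Suc[OF wf cs, of "C + 2" l] occ_from_Suc[OF wf cs, of "C + 2" "Suc l"]
        by (auto simp: eval_nat_numeral split: if_splits)
    qed
  qed
  have mE: "m \<in> elabels T (R, C + 1)" using m_props(4)[of m] l st by simp
  have nb: False if far: "(\<exists>r > R. label T (r, C + 2) = Some l) \<or> (\<exists>e > R. l \<in> elabels T (e, C + 2))"
  proof -
    obtain w where w: "label T (R + 1, C + 1) = Some w" "w \<le> l"
      using below_right_greater(2)[OF _ far] by auto
    then show False using column_strictD(3)[OF cs mE w(1)] l by simp
  qed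
  have "occurs T (C + 2) l" using oc l by simp
  then consider r where "label T (r, C + 2) = Some l" | e where "l \<in> elabels T (e, C + 2)"
    unfolding occurs_def by blast
  then show ?thesis
  proof cases
    case 1
    then show ?thesis using column_strictD(1)[OF cs 1 t] nb t l
      by (cases r R rule: linorder_cases) auto
  next
    case 2
    then show ?thesis using column_strictD(3)[OF cs 2 t] nb l
      by (cases e R rule: linorder_cases) auto
  qed
qed

abbreviation "T' \<equiv> horizontal_swap T (R, C)"

lemma horizontal_swap_sel:
  shows "in_shape T' = in_shape T" "out_shape T' = out_shape T" "bullet T' = Some (R, C + 1)"
    and "label T' = (label T)((R, C) := Some m, (R, C + 1) := None)"
    and "elabels T' = (elabels T)((R, C + 1) := elabels T (R, C + 1) - {s + 1..m},
       (R - 1, C) := elabels T (R - 1, C) \<union> {s..<m})"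
  using s by (simp_all add: horizontal_swap_def right_of_def upper_edge_def lower_edge_def Let_def
      r_label_def m_def)

lemma well_formed_horizontal_swap: "well_formed k n T'"
proof -
  note p = well_formed_label[OF wf s]
  have "R - 1 = 0 \<or> (R - 1, C) \<in> out_shape T"
    using young_diagram_down[OF young_out bullet_out, of "R - 1" C] R_C by (cases "R - 1 = 0") auto
  then have edge: "1 \<le> l \<and> c \<in> {1..n - k} \<and> (e = 0 \<or> (e, c) \<in> out_shape T) \<and> (e + 1, c) \<notin> in_shape T"
    if "l \<in> elabels T' (e, c)" for e c l
  proof (cases "l \<in> elabels T (e, c)")
    case True
    then show ?thesis using well_formed_edge[OF wf True] by simp
  next
    case False
    then have "e = R - 1 \<and> c = C \<and> s \<le> l"
      using that by (auto simp: horizontal_swap_sel split: if_splits)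
    then show ?thesis
      using \<open>R - 1 = 0 \<or> (R - 1, C) \<in> out_shape T\<close> p(1) R_C bullet_in by auto
  qed
  have "dom (label T) = out_shape T - in_shape T - {(R, C)}"
    using wf bullet by (simp add: well_formed_def)
  then have "dom (label T') = out_shape T - in_shape T - {(R, C + 1)}"
    using bullet_out bullet_in by (auto simp: horizontal_swap_sel)
  moreover have "1 \<le> l" if "label T' x = Some l" for x l
    using that s_le_m p(1) well_formed_label(1)[OF wf, of "fst x" "snd x" l]
    by (auto simp: horizontal_swap_sel split: if_splits)
  moreover have "finite (elabels T' e)" for e
    using finite_elabels by (simp add: horizontal_swap_sel)
  moreover have "out_shape T \<subseteq> rectangle k n" "in_shape T \<subseteq> out_shape T"
    using wf by (simp_all add: well_formed_def)
  ultimately show ?thesis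
    using edge young_in young_out p
    unfolding well_formed_def horizontal_swap_sel(1-3) by simp
qed

lemma column_strict_horizontal_swap: "column_strict T'"
proof -
  let ?U = "T\<lparr>label := (label T)((R, C + 1) := None),
    elabels := (elabels T)((R, C + 1) := elabels T (R, C + 1) - {s + 1..m})\<rparr>"
  let ?V = "?U\<lparr>label := (label ?U)((R, C) := Some m)\<rparr>"
  have csU: "column_strict ?U"
    by (rule column_strict_mono[OF cs]) (auto simp: map_le_def)
  have LV: "label ?V = (label ?U)((R, C) := Some m)" "elabels ?V = elabels ?U" by simp_all
  have csV: "column_strict ?V"
  proof (rule column_strict_box[OF csU LV])
    fix r l assume "label ?U (r, C) = Some l" "r < R"
    then have "l < s" using column_above by (auto split: if_splits)
    then show "l < m" using s_le_m by simp
  next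
    fix r l assume "label ?U (r, C) = Some l" "R < r"
    then show "m < l" using column_below by (auto split: if_splits)
  next
    fix e l assume "l \<in> elabels ?U (e, C)" "e < R"
    then have "l < s" using column_above by auto
    then show "l < m" using s_le_m by simp
  next
    fix e l assume "l \<in> elabels ?U (e, C)" "R \<le> e"
    then show "m < l" using column_below by auto
  qed
  have L2: "label T' = label ?V"
    "elabels T' = (elabels ?V)((R - 1, C) := elabels ?V (R - 1, C) \<union> {s..<m})"
    by (auto simp: horizontal_swap_sel)
  show ?thesis
  proof (rule column_strict_edge[OF csV L2])
    fix x r l assume x: "x \<in> {s..<m}" and l: "label ?V (r, C) = Some l" "r \<le> R - 1"
    have "r < R" using l R_C by simp
    then have "l < s" using l column_above by (auto split: if_splits)
    then show "l < x" using x by simp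
  next
    fix x r l assume x: "x \<in> {s..<m}" and l: "label ?V (r, C) = Some l" "R - 1 < r"
    have "m \<le> l"
    proof (cases "r = R")
      case False
      then have "r > R" "label T (r, C) = Some l" using l by auto
      then show ?thesis using column_below[of l] by (meson less_imp_le)
    qed (use l in simp)
    then show "x < l" using x by simp
  next
    fix x e l assume x: "x \<in> {s..<m}" and l: "l \<in> elabels ?V (e, C)" "e < R - 1"
    then have "e < R \<and> l \<in> elabels T (e, C)" by auto
    then have "l < s" using column_above by blast
    then show "l < x" using x by simp
  next
    fix x e l assume x: "x \<in> {s..<m}" and l: "l \<in> elabels ?V (e, C)" "R - 1 < e"
    then have "R \<le> e \<and> l \<in> elabels T (e, C)" by auto
    then have "m < l" using column_below by blast
    then show "x < l" using x by simp
  qed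
qed

lemma row_weak_horizontal_swap: "row_weak T'"
proof -
  let ?W = "T\<lparr>label := (label T)((R, C + 1) := None)\<rparr>"
  have rwW: "row_weak ?W" by (rule row_weak_mono[OF rw]) (auto simp: map_le_def)
  have LW: "label T' = (label ?W)((R, C) := Some m)" by (auto simp: horizontal_swap_sel)
  show ?thesis
    by (rule row_weak_box[OF rwW LW]) (use R_C m_props(2) in \<open>auto split: if_splits\<close>)
qed

text \<open>The labels \<open>s, ..., m\<close> move as a block: in column \<open>C + 1\<close> the
  box held \<open>s\<close> and the edge below it the rest, in column \<open>C\<close> the box holds
  \<open>m\<close> and the edge above it the rest.\<close>

lemma occurs_horizontal_swap:
  "occurs T' c l \<longleftrightarrow> (if c = C \<and> s \<le> l \<and> l \<le> m then True
     else if c = C + 1 \<and> s \<le> l \<and> l \<le> m then False else occurs T c l)"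
proof (cases "s \<le> l \<and> l \<le> m \<and> (c = C \<or> c = C + 1)")
  case True
  show ?thesis
  proof (cases "c = C")
    case True
    then have "occurs T' c l" using \<open>s \<le> l \<and> l \<le> m \<and> (c = C \<or> c = C + 1)\<close>
      unfolding occurs_def horizontal_swap_sel
      by (cases "l = m") (auto intro: exI[of _ R] exI[of _ "R - 1"])
    then show ?thesis using True \<open>s \<le> l \<and> l \<le> m \<and> (c = C \<or> c = C + 1)\<close> by simp
  next
    case False
    then have c: "c = C + 1" and l: "s \<le> l" "l \<le> m" using True by auto
    have "\<not> occurs T' c l"
    proof
      assume "occurs T' c l"
      then consider r where "r \<noteq> R" "label T (r, C + 1) = Some l"
        | e where "l \<in> elabels T (e, C + 1)" "e = R \<longrightarrow> l = s"
        unfolding occurs_def horizontal_swap_sel c using l by (auto split: if_splits)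
      then show False
      proof cases
        case 1
        show ?thesis
        proof (cases "l = s")
          case True
          then show ?thesis using 1 column_strictD(1)[OF cs 1(2) s] column_strictD(1)[OF cs s 1(2)]
            by (cases r R rule: linorder_cases) auto
        next
          case False
          then have "l \<in> elabels T (R, C + 1)" using m_props(4) l by simp
          then show ?thesis
            using 1 column_strictD(3)[OF cs _ 1(2), of l R] column_strictD(2)[OF cs 1(2), of l R]
            by (cases r R rule: linorder_cases) auto
        qed
      next
        case 2
        show ?thesis
        proof (cases "l = s")
          case True
          then show ?thesis using column_strictD(3)[OF cs 2(1) s] column_strictD(2)[OF cs s 2(1)]
            by (cases e R rule: linorder_cases) auto
        next
          case False
          then have "l \<in> elabels T (R, C + 1)" using m_props(4) l by simp
          then show ?thesis
            using False 2 column_strictD(4)[OF cs _ 2(1), of l R] column_strictD(4)[OF cs 2(1), of l R]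
            by (cases e R rule: linorder_cases) auto
        qed
      qed
    qed
    then show ?thesis using c l by simp
  qed
next
  case False
  have "occurs T' c l \<longleftrightarrow> occurs T c l"
  proof
    assume "occurs T' c l"
    then show "occurs T c l" unfolding occurs_def horizontal_swap_sel
      using False s_le_m by (auto split: if_splits)
  next
    assume "occurs T c l"
    then consider r where "label T (r, c) = Some l" | e where "l \<in> elabels T (e, c)"
      unfolding occurs_def by blast
    then show "occurs T' c l"
    proof cases
      case 1
      then show ?thesis using False s s_le_m bullet_unlabelled
        unfolding occurs_def horizontal_swap_sel by (intro disjI1 exI[of _ r]) auto
    next
      case 2
      then show ?thesis using False s_le_m
        unfolding occurs_def horizontal_swap_sel by (intro disjI2 exI[of _ e]) auto
    qed
  qed
  then show ?thesis using False by auto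
qed

text \<open>A move from column \<open>C + 1\<close> to \<open>C\<close> is seen only by the count
  that starts between them, at \<open>C + 1\<close>. The truncated subtraction is exact, as the
  labels concerned occur in column \<open>C + 1\<close>.\<close>

lemma occ_from_horizontal_swap:
  "occ_from T' c l =
     (if c = C + 1 \<and> s \<le> l \<and> l \<le> m then occ_from T c l - 1 else occ_from T c l)"
proof -
  note S' = occ_from_Suc[OF well_formed_horizontal_swap column_strict_horizontal_swap]
  note S = occ_from_Suc[OF wf cs]
  have far: "occ_from T' c l = occ_from T c l" if "c \<ge> C + 2" for c
  proof -
    have "{c'. c \<le> c' \<and> occurs T' c' l} = {c'. c \<le> c' \<and> occurs T c' l}"
      using that by (auto simp: occurs_horizontal_swap)
    then show ?thesis
      by (simp add: occ_from_eq[OF wf cs]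
          occ_from_eq[OF well_formed_horizontal_swap column_strict_horizontal_swap])
  qed
  have at1: "occ_from T' (C + 1) l =
      (if s \<le> l \<and> l \<le> m then occ_from T (C + 1) l - 1 else occ_from T (C + 1) l)"
    using S'[of "C + 1" l] S[of "C + 1" l] far[of "C + 2"] occurs_Suc_C[of l]
    by (simp add: occurs_horizontal_swap)
  have at0: "occ_from T' C l = occ_from T C l"
    using S'[of C l] S[of C l] S[of "C + 1" l] at1 occurs_Suc_C[of l] not_occurs_C[of l]
    by (simp add: occurs_horizontal_swap split: if_splits)
  have "occ_from T' c l = occ_from T c l" if "c \<le> C" for c
    using that
  proof (induction rule: inc_induct)
    case (step c)
    then show ?case using S'[of c l] S[of c l] by (simp add: occurs_horizontal_swap)
  qed (rule at0)
  then show ?thesis using far at1 by (cases "c \<le> C"; cases "c = C + 1") auto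
qed

lemma horizontal_swap_good: "good k n mu T'"
proof -
  note D = column_strictD[OF cs]
  note S = horizontal_swap_sel
  have "lattice T'" unfolding lattice_def
  proof (intro allI impI)
    \<comment> \<open>Inside the block both counts drop together, and for \<open>s\<close> against
      \<open>s - 1\<close> only the smaller side drops. The critical comparison is
      \<open>m + 1\<close> against \<open>m\<close>.\<close>
    fix c l :: nat assume "1 \<le> c" "1 \<le> l"
    then have "occ_from T c (l + 1) \<le> occ_from T c l" using lat unfolding lattice_def by blast
    then show "occ_from T' c (l + 1) \<le> occ_from T' c l"
      using Suc_m_fewer unfolding occ_from_horizontal_swap by (cases "l = m") auto
  qed
  moreover have "content T' = mu"
    using ct R_C by (auto simp: fun_eq_iff content_eq_occ_from occ_from_horizontal_swap)
  moreover have "bullet_ok T'"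
    unfolding bullet_ok_def S(3)
  proof (clarify, intro conjI allI impI ballI)
    fix a l assume "label T' (R, C + 1 - 1) = Some a" and l: "l \<in> elabels T' (R, C + 1)"
    then have "a = m" by (simp add: S)
    then show "a \<le> l" using D(2)[OF s, of l R] l by (auto simp: S)
  next
    fix t u assume t: "label T' (R, C + 1 + 1) = Some t" and u: "u \<in> elabels T' (R - 1, C + 1)"
    have "s \<le> t" using rw s t unfolding row_weak_def by (auto simp: S)
    moreover have "u < s" using D(3)[OF _ s, of u "R - 1"] u R_C by (auto simp: S split: if_splits)
    ultimately show "u \<le> t" by simp
  next
    \<comment> \<open>Here the row may descend, from \<open>m\<close> to \<open>t\<close>. The
      second alternative is proved in all cases; its interval conditions are trivial when
      \<open>m \<le> t\<close>.\<close>
    fix t a assume t: "label T' (R, C + 1 + 1) = Some t" and a: "label T' (R, C + 1 - 1) = Some a"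
    have am: "a = m" using a by (simp add: S)
    have t': "label T (R, C + 2) = Some t" using t by (simp add: S)
    have st: "s \<le> t" using rw s t' unfolding row_weak_def by auto
    have "t \<notin> elabels T' (R - 1, C + 1)"
      using D(3)[OF _ s, of t "R - 1"] st R_C by (auto simp: S split: if_splits)
    moreover have "{t + 1..a} \<subseteq> elabels T' (R, C + 1 + 1)"
      using next_column[OF t'] am by (auto simp: S)
    moreover have "occ_from T' (C + 1 + 1) l = occ_from T' (C + 1 + 1) t" if "t \<le> l" "l \<le> a" for l
    proof -
      have "occ_from T (C + 2) l' = occ_from T (C + 2) s" if "s \<le> l'" "l' \<le> m" for l'
        using occ_from_Suc[OF wf cs, of "C + 1" l'] occ_from_Suc[OF wf cs, of "C + 1" s] that s_le_m
          m_props(3)[OF that] occurs_Suc_C[OF that] occurs_Suc_C[of s] by simp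
      from this[of l] this[of t] show ?thesis using that am st by (simp add: occ_from_horizontal_swap)
    qed
    moreover have "\<forall>l \<in> elabels T' (R, C + 1). a < l"
      using D(2)[OF s, of _ R] am by (fastforce simp: S not_le)
    ultimately show "a \<le> t \<or> t \<notin> elabels T' (R - 1, C + 1) \<and> {t + 1..a} \<subseteq> elabels T' (R, C + 1 + 1) \<and>
         (\<forall>l. t \<le> l \<and> l \<le> a \<longrightarrow> occ_from T' (C + 1 + 1) l = occ_from T' (C + 1 + 1) t) \<and>
         (\<forall>l \<in> elabels T' (R, C + 1). a < l)" by blast
  qed
  ultimately show ?thesis
    using well_formed_horizontal_swap column_strict_horizontal_swap row_weak_horizontal_swap
    by (simp add: good_def)
qed

end

section \<open>Swaps preserve the a priori weight\<close>

text \<open>Being too high without the exception. The exception concerns a single label, at a bullet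
  about to resuscitate; in all other tableaux this simpler condition decides.\<close>

definition above_own_row :: "tableau \<Rightarrow> bool" where
  "above_own_row T \<longleftrightarrow> (\<exists>e c i. i \<in> elabels T (e, c) \<and> e < i) \<or> (\<exists>r c i. label T (r, c) = Some i \<and> r < i)"

definition too_high :: "tableau \<Rightarrow> bool" where
  "too_high T \<longleftrightarrow> (\<exists>e i. edge_too_high T e i) \<or> (\<exists>b i. box_too_high T b i)"

definition edge_labels :: "tableau \<Rightarrow> (edge \<times> nat) set" where
  "edge_labels T = {(e, i). i \<in> elabels T e}"

lemma mem_edge_labels [simp]: "(e, i) \<in> edge_labels T \<longleftrightarrow> i \<in> elabels T e"
  by (simp add: edge_labels_def)

lemma apwt_eq: "apwt k T = (if too_high T then 0 else \<Prod>(e, i) \<in> edge_labels T. apfactor k T e i)"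
  unfolding apwt_def too_high_def edge_labels_def ..

lemma edge_too_high_iff:
  "edge_too_high T (e, c) i \<longleftrightarrow> i \<in> elabels T (e, c) \<and> e < i \<and>
     \<not> (e = i - 1 \<and> bullet T = Some (i, c) \<and> resuscitates T (i, c) \<and> i = Max (elabels T (i - 1, c)))"
  by (auto simp: edge_too_high_def upper_edge_def)

lemma too_highI:
  shows "label T (r, c) = Some i \<Longrightarrow> r < i \<Longrightarrow> too_high T"
    and "i \<in> elabels T (e, c) \<Longrightarrow> e < i \<Longrightarrow>
      \<not> (e = i - 1 \<and> bullet T = Some (i, c) \<and> resuscitates T (i, c) \<and> i = Max (elabels T (i - 1, c))) \<Longrightarrow> too_high T"
  unfolding too_high_def using edge_too_high_iff by (auto simp: box_too_high_def) blast

lemma too_highE: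
  assumes "too_high T"
  obtains r c i where "label T (r, c) = Some i" "r < i"
  | e c i where "i \<in> elabels T (e, c)" "e < i"
    "\<not> (e = i - 1 \<and> bullet T = Some (i, c) \<and> resuscitates T (i, c) \<and> i = Max (elabels T (i - 1, c)))"
  using assms unfolding too_high_def split_paired_Ex edge_too_high_iff box_too_high_def by auto

lemma above_own_rowE:
  assumes "above_own_row T"
  obtains r c i where "label T (r, c) = Some i" "r < i" | e c i where "i \<in> elabels T (e, c)" "e < i"
  using assms unfolding above_own_row_def by blast

lemma above_own_rowI:
  "label T (r, c) = Some i \<Longrightarrow> r < i \<Longrightarrow> above_own_row T"
  "i \<in> elabels T (e, c) \<Longrightarrow> e < i \<Longrightarrow> above_own_row T"
  unfolding above_own_row_def by blast+

lemma too_high_above: "too_high T \<Longrightarrow> above_own_row T"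
  by (elim too_highE) (auto intro: above_own_rowI)

lemma too_high_iff_above:
  assumes "\<And>x. bullet T = Some x \<Longrightarrow> \<not> resuscitates T x"
  shows "too_high T \<longleftrightarrow> above_own_row T"
  using too_high_above by (auto elim!: above_own_rowE intro: too_highI simp: assms)

lemma vertical_not_horizontal: "goes_vertical T x \<Longrightarrow> \<not> goes_horizontal T x"
  by (auto simp: goes_vertical_def goes_horizontal_def)

lemma vertical_not_resuscitates: "goes_vertical T x \<Longrightarrow> \<not> resuscitates T x"
  using vertical_not_horizontal by (auto simp: resuscitates_def)

lemma apfactor_cong: "occ_from T' = occ_from T \<Longrightarrow> apfactor k T' = apfactor k T"
  by (simp add: apfactor_def fun_eq_iff)

text \<open>Meant for placing and erasing the bullet: no label moves, so the weight could change
  only through the exception for resuscitation.\<close>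

lemma apwt_cong:
  assumes "label T' = label T" "elabels T' = elabels T"
    and "\<And>x. bullet T = Some x \<Longrightarrow> \<not> resuscitates T x" "\<And>x. bullet T' = Some x \<Longrightarrow> \<not> resuscitates T' x"
  shows "apwt k T' = apwt k T"
proof -
  have "occ_from T' = occ_from T" using assms by (simp add: fun_eq_iff occ_from_def)
  then have "apfactor k T' = apfactor k T" by (rule apfactor_cong)
  moreover have "edge_labels T' = edge_labels T" using assms by (simp add: edge_labels_def)
  moreover have "above_own_row T' = above_own_row T" using assms by (simp add: above_own_row_def)
  moreover have "too_high T = above_own_row T" using assms(3) by (rule too_high_iff_above)
  moreover have "too_high T' = above_own_row T'" using assms(4) by (rule too_high_iff_above)
  ultimately show ?thesis by (simp add: apwt_eq)
qed

context bulleted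
begin

lemma finite_edge_labels': "finite (edge_labels T)"
  unfolding edge_labels_def using finite_edge_labels[OF wf] .

text \<open>With no label right of the bullet, no column further right reaches row \<open>R\<close>,
  so a copy of \<open>R\<close> there sits above its own row.\<close>

lemma nothing_right:
  assumes "label T (R, C + 1) = None" "occurs T c R" "C < c"
  shows "above_own_row T"
proof -
  have no: "(r, c) \<notin> out_shape T" if "R \<le> r" for r
  proof
    assume "(r, c) \<in> out_shape T"
    then have "(R, C + 1) \<in> out_shape T"
      using young_diagram_down[OF young_out] that assms R_C by auto
    then show False using southeast_labelled[of R "C + 1"] assms by auto
  qed
  consider r where "label T (r, c) = Some R" | e where "R \<in> elabels T (e, c)"
    using assms unfolding occurs_def by blast
  then show ?thesis
  proof cases
    case 1
    then show ?thesis using no[of r] well_formed_label(2)[OF wf 1] above_own_rowI(1)[OF 1]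
      by (cases "R \<le> r") auto
  next
    case 2
    then show ?thesis using no[of e] well_formed_edge(4)[OF wf 2] R_C above_own_rowI(2)[OF 2]
      by (cases "R \<le> e") auto
  qed
qed

lemma vertical_swap_apwt:
  assumes v: "goes_vertical T (R, C)" and E: "elabels T (R, C) = {}"
  shows "apwt k (vertical_swap T (R, C)) = apwt k T"
proof -
  let ?T = "vertical_swap T (R, C)"
  obtain z where z: "label T (R + 1, C) = Some z" "\<And>s. label T (R, C + 1) = Some s \<Longrightarrow> z \<le> s"
    using v E by (auto simp: goes_vertical_def b_label_def r_label_def lower_edge_def below_def right_of_def)
  have L: "label ?T = (label T)((R, C) := Some z, (R + 1, C) := None)"
    using z by (simp add: vertical_swap_def below_def)
  have F: "elabels ?T = elabels T" and B: "bullet ?T = Some (R + 1, C)"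
    by (simp_all add: vertical_swap_def below_def)
  \<comment> \<open>Only \<open>z = R + 1\<close> becomes too high by moving up. A right neighbour
    is at least \<open>z\<close> and already too high. Without one, latticeness asks for a copy of
    \<open>R\<close> weakly right of column \<open>C\<close>: in column \<open>C\<close> it lies
    above \<open>z\<close> and not at the bullet, thus above row \<open>R\<close>; further right
    \<open>nothing_right\<close> applies.\<close>
  have high: "above_own_row T" if "z = R + 1"
  proof (cases "label T (R, C + 1)")
    case (Some s)
    then show ?thesis using z(2) that by (auto intro: above_own_rowI(1)[OF Some])
  next
    case None
    have "occurs T C (R + 1)" using z(1) that unfolding occurs_def by blast
    then have "0 < occ_from T C (R + 1)" using occ_from_pos[OF wf cs, of C] by blast
    also have "\<dots> \<le> occ_from T C R" using lat R_C unfolding lattice_def by simp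
    finally obtain c where c: "c \<ge> C" "occurs T c R" using occ_from_pos[OF wf cs] by blast
    show ?thesis
    proof (cases "c = C")
      case True
      then consider r where "label T (r, C) = Some R" | e where "R \<in> elabels T (e, C)"
        using c unfolding occurs_def by blast
      then show ?thesis
      proof cases
        case 1
        then have "r < R" using column_strictD(1)[OF cs z(1) 1] that bullet_unlabelled z(1)
          by (cases r R rule: linorder_cases; cases "r = R + 1") auto
        then show ?thesis using 1 by (auto intro: above_own_rowI)
      next
        case 2
        then have "e < R" using column_strictD(2)[OF cs z(1) 2] that E
          by (cases e R rule: linorder_cases) auto
        then show ?thesis using above_own_rowI(2)[OF 2] by simp
      qed
    qed (use nothing_right[OF None c(2)] c in simp)
  qed
  have "above_own_row ?T \<longleftrightarrow> above_own_row T"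
  proof
    assume "above_own_row ?T"
    then show "above_own_row T"
    proof (cases rule: above_own_rowE)
      case (1 r c i)
      then show ?thesis using z(1) high
        by (cases "(r, c) = (R, C)"; cases "z = R + 1")
          (auto simp: L split: if_splits intro: above_own_rowI)
    next
      case (2 e c i)
      then show ?thesis using F by (auto intro: above_own_rowI)
    qed
  next
    assume "above_own_row T"
    then show "above_own_row ?T"
    proof (cases rule: above_own_rowE)
      case (1 r c i)
      show ?thesis
      proof (cases "(r, c) = (R + 1, C)")
        case True
        then show ?thesis using 1 z(1) by (intro above_own_rowI(1)[of ?T R C z]) (auto simp: L)
      next
        case False
        then show ?thesis using 1 bullet_unlabelled by (intro above_own_rowI(1)[of ?T r c i]) (auto simp: L)
      qed
    next
      case (2 e c i)
      then show ?thesis using F by (auto intro: above_own_rowI)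
    qed
  qed
  moreover have "\<not> resuscitates ?T x" if "bullet ?T = Some x" for x
    using that B F E by (auto simp: resuscitates_def upper_edge_def)
  moreover have "\<not> resuscitates T x" if "bullet T = Some x" for x
    using that bullet vertical_not_resuscitates[OF v] by simp
  moreover have "apfactor k ?T = apfactor k T"
    using vertical_swap_good[OF assms] by (intro apfactor_cong) simp
  ultimately show ?thesis by (simp add: apwt_eq too_high_iff_above edge_labels_def F)
qed

lemma expansion_swap_apwt:
  assumes v: "goes_vertical T (R, C)" and E: "elabels T (R, C) \<noteq> {}"
  shows "beta k (R, C) * apwt k (expand_box T (R, C)) + apwt k (expand_edge T (R, C)) = apwt k T"
proof -
  let ?T1 = "expand_box T (R, C)" and ?T2 = "expand_edge T (R, C)"
  define b where "b = Min (elabels T (R, C))"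
  note b = expansion_label[OF v E b_def]
  note D = column_strictD[OF cs]
  have L1: "label ?T1 = (label T)((R, C) := Some b)" and F1: "elabels ?T1 = (elabels T)((R, C) := elabels T (R, C) - {b})"
    and B1: "bullet ?T1 = None"
    by (simp_all add: expand_box_def b_def)
  have L2: "label ?T2 = label T" and B2: "bullet ?T2 = Some (R, C)"
    and F2: "elabels ?T2 e = (if e = (R, C) then elabels T e - {b} else
      if e = (R - 1, C) then insert b (elabels T e) else elabels T e)" for e
    using R_C bullet by (auto simp: expand_edge_def Let_def upper_edge_def b_def)
  have b_upper: "u < b" if "u \<in> elabels T (R - 1, C)" for u
    using D(4)[OF that b(1)] R_C by simp
  have Max2: "Max (elabels ?T2 (R - 1, C)) = b"
  proof -
    have "elabels ?T2 (R - 1, C) = insert b (elabels T (R - 1, C))" using R_C by (auto simp: F2)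
    then show ?thesis using b_upper finite_elabels[of "(R - 1, C)"] by (intro Max_eqI) fastforce+
  qed
  have af: "apfactor k ?T1 = apfactor k T" "apfactor k ?T2 = apfactor k T"
    using expand_box_good[OF v E b_def] expand_edge_good[OF v E b_def] by (auto intro: apfactor_cong)
  have nr: "\<not> resuscitates T x" if "bullet T = Some x" for x
    using that bullet vertical_not_resuscitates[OF v] by simp
  note th = too_high_iff_above[OF nr]
  have th1: "too_high ?T1 \<longleftrightarrow> above_own_row ?T1" using B1 by (intro too_high_iff_above) simp
  show ?thesis
  proof (cases "above_own_row T")
    case True
    \<comment> \<open>In \<open>?T2\<close> the exception could save only \<open>b\<close>, the
      largest label on the upper edge, and only if \<open>b = R\<close>. But if \<open>b\<close> is
      too high in \<open>T\<close>, then \<open>b > R\<close>; and other labels on that edge are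
      smaller than \<open>b\<close>.\<close>
    have "too_high ?T2" using True
    proof (cases rule: above_own_rowE)
      case (1 r c i)
      then show ?thesis by (intro too_highI(1)[of ?T2 r c i]) (auto simp: L2)
    next
      case (2 e c i)
      show ?thesis
      proof (cases "(e, c) = (R, C) \<and> i = b")
        case True
        then show ?thesis using 2 R_C B2 by (intro too_highI(2)[of b ?T2 "R - 1" C]) (auto simp: F2)
      next
        case False
        have "\<not> (e = i - 1 \<and> bullet ?T2 = Some (i, c) \<and> resuscitates ?T2 (i, c) \<and> i = Max (elabels ?T2 (i - 1, c)))"
          using B2 Max2 2 b_upper[of i] by auto
        then show ?thesis using 2 False by (intro too_highI(2)[of i ?T2 e c]) (auto simp: F2)
      qed
    qed
    moreover have "above_own_row ?T1" using True
    proof (cases rule: above_own_rowE)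
      case (1 r c i)
      then show ?thesis using bullet_unlabelled by (intro above_own_rowI(1)[of ?T1 r c i]) (auto simp: L1)
    next
      case (2 e c i)
      then show ?thesis
        by (cases "(e, c) = (R, C) \<and> i = b")
          (auto intro: above_own_rowI(1)[of ?T1 R C b] above_own_rowI(2)[of i ?T1 e c] simp: L1 F1)
    qed
    ultimately show ?thesis using True th th1 by (simp add: apwt_eq)
  next
    case False
    let ?X = "edge_labels T - {((R, C), b)}"
    have b_le: "b \<le> R" using False b(1) above_own_rowI(2)[of b T R C] by (meson not_le)
    have "\<not> above_own_row ?T1"
      using False b_le by (auto simp: L1 F1 above_own_row_def split: if_splits)
    moreover have X1: "edge_labels ?T1 = ?X" by (auto simp: F1 split: if_splits)
    ultimately have w1: "apwt k ?T1 = (\<Prod>(e, i) \<in> ?X. apfactor k T e i)"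
      by (simp add: apwt_eq th1 af)
    have "insert ((R, C), b) ?X = edge_labels T" using b(1) by auto
    then have w: "apwt k T = apfactor k T (R, C) b * (\<Prod>(e, i) \<in> ?X. apfactor k T e i)"
      using False th finite_edge_labels' prod.insert[of ?X "((R, C), b)" "\<lambda>(e, i). apfactor k T e i"]
      by (simp add: apwt_eq)
    have X2: "edge_labels ?T2 = insert ((R - 1, C), b) ?X" using R_C by (auto simp: F2 split: if_splits)
    have notX: "((R - 1, C), b) \<notin> ?X" using b_upper by auto
    have w2: "(\<Prod>(e, i) \<in> edge_labels ?T2. apfactor k ?T2 e i) =
        apfactor k T (R - 1, C) b * (\<Prod>(e, i) \<in> ?X. apfactor k T e i)"
      using notX finite_edge_labels' prod.insert[of ?X "((R - 1, C), b)" "\<lambda>(e, i). apfactor k T e i"]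
      by (simp add: X2 af)
    \<comment> \<open>The truncated subtraction in \<open>man\<close> is exact because
      \<open>R \<le> k\<close>, so \<open>man\<close> plus the row is the same for both
      edges.\<close>
    have af_b: "apfactor k T (R, C) b = beta k (R, C) + apfactor k T (R - 1, C) b"
      using R_C by (simp add: apfactor_def beta_def man_def Suc_diff_le)
    \<comment> \<open>\<open>?T2\<close> is too high only if \<open>b = R\<close> sits on the upper
      edge without being saved. A right neighbour would equal \<open>R\<close> and save it, so there
      is none; then no \<open>R\<close> occurs further right, and with \<open>N = 0\<close> the two
      indices of the factor coincide.\<close>
    have zero: "apfactor k T (R - 1, C) b = 0" if high: "too_high ?T2"
    proof -
      have bR: "b = R \<and> \<not> resuscitates ?T2 (R, C)" using high
      proof (cases rule: too_highE)
        case (1 r c i)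
        then show ?thesis using False by (auto simp: L2 intro: above_own_rowI)
      next
        case (2 e c i)
        have "i \<notin> elabels T (e, c)" using False 2(2) above_own_rowI(2) by blast
        then have "(e, c) = (R - 1, C)" "i = b" using 2(1) by (auto simp: F2 split: if_splits)
        moreover from this have "b = R" using 2(2) b_le by simp
        ultimately show ?thesis using 2(3) Max2 B2 by simp
      qed
      have "label T (R, C + 1) = None"
      proof (rule ccontr)
        assume "label T (R, C + 1) \<noteq> None"
        then obtain s where s: "label T (R, C + 1) = Some s" by blast
        then have sR: "s = R" using b(3)[OF s] False above_own_rowI(1)[OF s] bR by (meson le_antisym not_le)
        have "s < b'" if "b_label ?T2 (R, C) = Some b'" for b'
        proof (cases "elabels ?T2 (R, C) = {}")
          case True
          then show ?thesis using that D(3)[OF b(1), of "R + 1" b'] sR bR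
            by (simp add: b_label_def lower_edge_def below_def L2)
        next
          case ne: False
          have fin: "finite (elabels ?T2 (R, C))" using finite_elabels by (simp add: F2)
          have "b' \<in> elabels ?T2 (R, C)" using that ne Min_in[OF fin ne]
            by (simp add: b_label_def lower_edge_def)
          then show ?thesis using b(2)[of b'] bR sR by (simp add: F2)
        qed
        then have "goes_horizontal ?T2 (R, C)"
          using s by (simp add: goes_horizontal_def r_label_def right_of_def L2)
        moreover have "b \<in> elabels ?T2 (R - 1, C)" using R_C by (auto simp: F2)
        ultimately have "resuscitates ?T2 (R, C)"
          using s sR bR Max2 by (auto simp: resuscitates_def upper_edge_def r_label_def right_of_def L2)
        then show False using bR by simp
      qed
      then have "\<forall>c \<ge> C + 1. \<not> occurs T c R" using nothing_right False by fastforce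
      then have "occ_from T (C + 1) R = 0" using occ_from_pos[OF wf cs, of "C + 1" R] by auto
      then show ?thesis using bR R_C by (simp add: apfactor_def man_def Suc_diff_le)
    qed
    have "apwt k ?T2 = apfactor k T (R - 1, C) b * (\<Prod>(e, i) \<in> ?X. apfactor k T e i)"
      using w2 zero by (simp add: apwt_eq)
    then show ?thesis using w w1 af_b by (simp add: algebra_simps)
  qed
qed

text \<open>In effect the edge label \<open>s\<close> moves from \<open>(R - 1, C)\<close> to
  \<open>(R, C + 1)\<close>. Both edges have the same \<open>man\<close>; in the second index the
  column grows by one, while \<open>N\<close> drops by one because the copy in column
  \<open>C + 1\<close> is no longer counted.\<close>

lemma resuscitation_swap_apwt:
  assumes h: "goes_horizontal T (R, C)" and s: "label T (R, C + 1) = Some s"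
    and u: "s \<in> elabels T (R - 1, C)"
  shows "apwt k (resuscitation_swap T (R, C)) = apwt k T"
proof -
  let ?T = "resuscitation_swap T (R, C)"
  note D = column_strictD[OF cs]
  have Max: "Max (elabels T (R - 1, C)) = s"
    using u bullet_okD(2)[OF s] finite_elabels by (intro Max_eqI)
  have B: "bullet ?T = Some (R, C + 1)"
    and L: "label ?T = (label T)((R, C) := Some s, (R, C + 1) := None)"
    and F: "elabels ?T = (elabels T)((R - 1, C) := elabels T (R - 1, C) - {s},
       (R, C + 1) := elabels T (R, C + 1) \<union> {s})"
    using Max s
    by (simp_all add: resuscitation_swap_def right_of_def upper_edge_def lower_edge_def Let_def r_label_def)
  have res: "resuscitates T (R, C)"
    using h s u Max by (auto simp: resuscitates_def upper_edge_def r_label_def right_of_def)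
  have new: "s \<notin> elabels T (R, C + 1)" using D(2)[OF s, of s R] by auto
  \<comment> \<open>The new lower edge contains \<open>s\<close>, which is at most the next label
    \<open>t\<close>, so the bullet does not move right next and the exception cannot apply to
    \<open>?T\<close>.\<close>
  have "\<not> goes_horizontal ?T (R, C + 1)"
  proof
    assume "goes_horizontal ?T (R, C + 1)"
    then obtain t where t: "label T (R, C + 2) = Some t" "\<And>b. b_label ?T (R, C + 1) = Some b \<Longrightarrow> t < b"
      by (auto simp: goes_horizontal_def r_label_def right_of_def L)
    have "Min (elabels ?T (R, C + 1)) \<le> s" using finite_elabels by (simp add: F)
    moreover have "t < Min (elabels ?T (R, C + 1))"
      by (rule t(2)) (simp add: b_label_def lower_edge_def F)
    moreover have "s \<le> t" using rw s t(1) unfolding row_weak_def by auto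
    ultimately show False by simp
  qed
  then have "\<not> resuscitates ?T x" if "bullet ?T = Some x" for x
    using that B by (auto simp: resuscitates_def)
  note th' = too_high_iff_above[OF this]
  have th: "above_own_row ?T \<longleftrightarrow> too_high T"
  proof
    assume "above_own_row ?T"
    then show "too_high T"
    proof (cases rule: above_own_rowE)
      case (1 r c i)
      then show ?thesis using s
        by (cases "(r, c) = (R, C)") (auto simp: L split: if_splits intro: too_highI(1))
    next
      case (2 e c i)
      show ?thesis
      proof (cases "(e, c) = (R, C + 1) \<and> i = s")
        case True
        then show ?thesis using s 2 by (auto intro: too_highI(1))
      next
        case False
        then have "i \<in> elabels T (e, c)" "(e, c) = (R - 1, C) \<Longrightarrow> i \<noteq> s" using 2(1) R_C
          by (auto simp: F split: if_splits)
        then show ?thesis using 2(2) bullet Max by (intro too_highI(2)[of i T e c]) auto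
      qed
    qed
  next
    assume "too_high T"
    then show "above_own_row ?T"
    proof (cases rule: too_highE)
      case (1 r c i)
      show ?thesis
      proof (cases "(r, c) = (R, C + 1)")
        case True
        then show ?thesis using 1 s by (intro above_own_rowI(1)[of ?T R C s]) (auto simp: L)
      next
        case False
        then show ?thesis using 1 bullet_unlabelled by (intro above_own_rowI(1)[of ?T r c i]) (auto simp: L)
      qed
    next
      case (2 e c i)
      show ?thesis
      proof (cases "(e, c) = (R - 1, C) \<and> i = s")
        case True
        \<comment> \<open>The copy of \<open>s\<close> on the upper edge is exempt when
          \<open>s = R\<close>. If it is not exempt, it exceeds \<open>R\<close> and remains too
          high in the box.\<close>
        then have "s \<noteq> R" using 2 bullet res Max by auto
        then have "R < s" using 2 True by simp
        then show ?thesis by (intro above_own_rowI(1)[of ?T R C s]) (auto simp: L)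
      next
        case False
        then show ?thesis using 2 by (intro above_own_rowI(2)[of i ?T e c]) (auto simp: F)
      qed
    qed
  qed
  let ?X = "edge_labels T - {((R - 1, C), s)}"
  have X': "edge_labels ?T = insert ((R, C + 1), s) ?X" by (auto simp: F split: if_splits)
  have af: "apfactor k ?T = apfactor k T"
    using resuscitation_swap_good[OF assms] by (intro apfactor_cong) simp
  have "occurs T (C + 1) s" using s unfolding occurs_def by blast
  then have "occ_from T (C + 1) s = occ_from T (C + 2) s + 1" using occ_from_Suc[OF wf cs, of "C + 1" s] by simp
  then have afs: "apfactor k T (R, C + 1) s = apfactor k T (R - 1, C) s"
    using R_C by (simp add: apfactor_def man_def Suc_diff_le)
  have "(\<Prod>(e, i) \<in> edge_labels ?T. apfactor k ?T e i) = apfactor k T (R, C + 1) s * (\<Prod>(e, i) \<in> ?X. apfactor k T e i)"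
    using new finite_edge_labels' prod.insert[of ?X "((R, C + 1), s)" "\<lambda>(e, i). apfactor k T e i"]
    by (simp add: X' af)
  also have "\<dots> = (\<Prod>(e, i) \<in> edge_labels T. apfactor k T e i)"
    unfolding afs using u finite_edge_labels'
      prod.remove[of "edge_labels T" "((R - 1, C), s)" "\<lambda>(e, i). apfactor k T e i"] by simp
  finally show ?thesis by (simp add: apwt_eq th th')
qed

end

context bulleted_horizontal
begin

text \<open>The label \<open>i\<close> on \<open>(R - 1, C)\<close> after the swap is matched with
  \<open>i + 1\<close> on \<open>(R, C + 1)\<close> before it. Both edges have the same
  \<open>man\<close>; in the second index the changes of row plus \<open>man\<close> and of the
  label cancel, and the values of \<open>N\<close> agree because the counts of
  \<open>s, ..., m\<close> from column \<open>C + 1\<close> are equal.\<close>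

lemma horizontal_swap_apwt: "apwt k T' = apwt k T"
proof -
  note D = column_strictD[OF cs]
  note S = horizontal_swap_sel
  have nr: "\<not> resuscitates T x" if "bullet T = Some x" for x
  proof
    assume "resuscitates T x"
    then have "elabels T (R - 1, C) \<noteq> {}" "s = Max (elabels T (R - 1, C))"
      using that bullet s by (auto simp: resuscitates_def upper_edge_def r_label_def right_of_def)
    then show False using Max_in[OF finite_elabels, of "(R - 1, C)"] not_u by simp
  qed
  have th: "too_high T' \<longleftrightarrow> above_own_row T"
  \<comment> \<open>If \<open>m > R\<close>, then \<open>m\<close> is too high on both sides:
    before, in the box or on the lower edge of \<open>(R, C + 1)\<close>; after, in row
    \<open>R\<close>. Otherwise no moved label is too high on either side, since at most
    \<open>R - 1\<close> lands on the edge \<open>(R - 1, C)\<close>.\<close>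
  proof (cases "R < m")
    case True
    have "too_high T'" by (rule too_highI(1)[of _ R C m]) (use True in \<open>auto simp: S\<close>)
    moreover have "above_own_row T"
    proof (cases "m = s")
      case True
      then show ?thesis using \<open>R < m\<close> above_own_rowI(1)[OF s] by simp
    next
      case False
      then have "m \<in> elabels T (R, C + 1)" using s_le_m m_props(4)[of m] by simp
      then show ?thesis using True by (rule above_own_rowI(2))
    qed
    ultimately show ?thesis by simp
  next
    case False
    show ?thesis
    proof
      assume "too_high T'"
      then have "above_own_row T'" by (rule too_high_above)
      then show "above_own_row T"
      proof (cases rule: above_own_rowE)
        case (1 r c i)
        then show ?thesis using False by (auto simp: S split: if_splits intro: above_own_rowI)
      next
        case (2 e c i)
        then show ?thesis using False by (auto simp: S split: if_splits intro: above_own_rowI)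
      qed
    next
      assume "above_own_row T"
      then show "too_high T'"
      proof (cases rule: above_own_rowE)
        case (1 r c i)
        then show ?thesis using False s s_le_m bullet_unlabelled
          by (intro too_highI(1)[of T' r c i]) (auto simp: S)
      next
        case (2 e c i)
        \<comment> \<open>The exception would need the label \<open>R\<close> on the upper edge of
          the new bullet, but labels there are smaller than \<open>s\<close>, and
          \<open>s \<le> m \<le> R\<close>.\<close>
        have "\<not> (e = i - 1 \<and> bullet T' = Some (i, c))"
          using D(3)[OF 2(1), of R s] s 2 s_le_m False by (auto simp: S)
        moreover have "i \<in> elabels T' (e, c)" using 2 False by (auto simp: S)
        ultimately show ?thesis using 2 by (intro too_highI(2)[of i T' e c]) auto
      qed
    qed
  qed
  let ?f = "\<lambda>(e, i). apfactor k T e i" and ?f' = "\<lambda>(e, i). apfactor k T' e i"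
  let ?A = "{(R, C + 1)} \<times> {s + 1..m}" and ?B = "{(R - 1, C)} \<times> {s..<m}"
  let ?K = "edge_labels T - ?A"
  have fin: "finite ?K" "finite ?A" "finite ?B" using finite_edge_labels' by auto
  have A: "?A \<subseteq> edge_labels T" using m_props(4) by (auto simp: Suc_le_eq)
  have BK: "?K \<inter> ?B = {}"
  proof -
    have "i \<notin> elabels T (R - 1, C)" if "s \<le> i" "i < m" for i
      using not_occurs_C[of i] that unfolding occurs_def by auto
    then show ?thesis by auto
  qed
  have el: "edge_labels T' = ?K \<union> ?B" using R_C by (auto simp: S split: if_splits)
  \<comment> \<open>A changed count starts at \<open>C + 1\<close> and concerns a label from
    \<open>s\<close> to \<open>m\<close>. An edge label using it would lie in column
    \<open>C\<close>, which holds none of these labels before the swap.\<close>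
  have "(\<Prod>x \<in> ?K. ?f' x) = (\<Prod>x \<in> ?K. ?f x)"
  proof (intro prod.cong refl)
    fix x assume x: "x \<in> ?K"
    obtain e c i where xe: "x = ((e, c), i)" by (metis surj_pair)
    have "occ_from T' (c + 1) i = occ_from T (c + 1) i"
      using x not_occurs_C[of i] unfolding occ_from_horizontal_swap xe occurs_def by auto
    then show "?f' x = ?f x" by (simp add: xe apfactor_def)
  qed
  moreover have "(\<Prod>x \<in> ?B. ?f' x) = (\<Prod>x \<in> ?A. ?f x)"
  proof -
    have "(\<Prod>x \<in> ?B. ?f' x) = (\<Prod>i \<in> {s..<m}. apfactor k T' (R - 1, C) i)"
      by (simp add: prod.cartesian_product[symmetric])
    also have "\<dots> = (\<Prod>i \<in> {s..<m}. apfactor k T (R, C + 1) (Suc i))"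
    proof (intro prod.cong refl)
      fix i assume i: "i \<in> {s..<m}"
      then have "occ_from T' (C + 1) i = occ_from T (C + 2) (Suc i)"
        using occ_from_Suc[OF wf cs, of "C + 1" "Suc i"] m_props(3)[of i] m_props(3)[of "Suc i"]
          occurs_Suc_C[of "Suc i"] by (simp add: occ_from_horizontal_swap)
      then show "apfactor k T' (R - 1, C) i = apfactor k T (R, C + 1) (Suc i)"
        using R_C by (simp add: apfactor_def man_def Suc_diff_le)
    qed
    also have "\<dots> = (\<Prod>i \<in> {s + 1..m}. apfactor k T (R, C + 1) i)"
      by (simp add: prod.shift_bounds_Suc_ivl[symmetric] atLeastLessThanSuc_atLeastAtMost)
    also have "\<dots> = (\<Prod>x \<in> ?A. ?f x)"
      by (simp add: prod.cartesian_product[symmetric])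
    finally show ?thesis .
  qed
  ultimately have "(\<Prod>x \<in> edge_labels T'. ?f' x) = (\<Prod>x \<in> ?K. ?f x) * (\<Prod>x \<in> ?A. ?f x)"
    unfolding el using prod.union_disjoint[OF fin(1,3) BK, of ?f'] by simp
  also have "\<dots> = (\<Prod>x \<in> edge_labels T. ?f x)"
    using prod.subset_diff[OF A finite_edge_labels', of ?f] by simp
  finally show ?thesis using th too_high_iff_above[OF nr] by (simp add: apwt_eq)
qed

end

section \<open>Rectification\<close>

text \<open>A lexicographic order coded as one number. A step of the bullet right or down raises
  \<open>r + c\<close>, which is at most \<open>n\<close>; the new lower edge carries at most as
  many labels as occur in \<open>mu\<close>, fewer than one step is worth. An expansion that keeps
  the bullet takes a label off its lower edge. Swaps preserve the content, so the bound is
  uniform.\<close>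

definition jdt_measure :: "nat \<Rightarrow> (nat \<Rightarrow> nat) \<Rightarrow> tableau \<Rightarrow> nat" where
  "jdt_measure n mu T = (case bullet T of None \<Rightarrow> 0 | Some (r, c) \<Rightarrow>
     (n + 1 - (r + c)) * (card {l. mu l \<noteq> 0} + 1) + card (elabels T (r, c)))"

lemma good_finite_content:
  assumes "good k n mu T"
  shows "finite {l. mu l \<noteq> 0}" "elabels T e \<subseteq> {l. mu l \<noteq> 0}"
proof -
  have wf: "well_formed k n T" and cs: "column_strict T" and ct: "content T = mu"
    using assms by (auto simp: good_def)
  have mu: "mu l \<noteq> 0 \<longleftrightarrow> (\<exists>c. occurs T c l)" for l
    using occ_from_pos[OF wf cs, of 0 l] unfolding ct[symmetric] content_eq_occ_from by simp
  have "{l. mu l \<noteq> 0} \<subseteq> ran (label T) \<union> snd ` {(e, i). i \<in> elabels T e}"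
    unfolding mu occurs_def by (auto simp: ran_def image_iff)
  moreover have "finite (dom (label T))"
    using wf by (simp add: well_formed_def young_diagram_def)
  ultimately show "finite {l. mu l \<noteq> 0}"
    using finite_edge_labels[OF wf] by (meson finite_ran finite_UnI finite_imageI finite_subset)
  show "elabels T e \<subseteq> {l. mu l \<noteq> 0}"
    unfolding mu occurs_def by (cases e) auto
qed

context bulleted
begin

lemma sum_le: "R + C \<le> n"
  using R_C by simp

lemma jdt_measure_right_down:
  assumes V: "good k n mu V" "bullet V = Some (r, c)" "r + c = R + C + 1"
  shows "jdt_measure n mu V < jdt_measure n mu T"
proof -
  interpret V: bulleted k n mu V r c using V by unfold_locales
  let ?K = "card {l. mu l \<noteq> 0}"
  have "card (elabels V (r, c)) \<le> ?K"
    using good_finite_content[OF V(1)] by (intro card_mono) auto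
  moreover have "n + 1 - (R + C) = Suc (n + 1 - (r + c))" using V.sum_le V(3) by simp
  ultimately show ?thesis using V(2) bullet by (simp add: jdt_measure_def)
qed

lemma swap_correct:
  assumes "can_swap T"
  shows "(\<forall>V \<in> Poly_Mapping.keys (swap k T). good k n mu V \<and> in_shape V = in_shape T \<and>
            (can_swap V \<longrightarrow> jdt_measure n mu V < jdt_measure n mu T)) \<and>
         lin_ext (apwt k) (swap k T) = apwt k T"
proof (cases "goes_vertical T (R, C)")
  case v: True
  show ?thesis
  proof (cases "elabels T (R, C) = {}")
    case True
    then have sw: "swap k T = Poly_Mapping.single (vertical_swap T (R, C)) 1"
      using v bullet by (simp add: swap_def lower_edge_def)
    have "bullet (vertical_swap T (R, C)) = Some (R + 1, C)"
      "in_shape (vertical_swap T (R, C)) = in_shape T"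
      by (simp_all add: vertical_swap_def below_def)
    then show ?thesis
      using vertical_swap_good[OF v True] vertical_swap_apwt[OF v True] jdt_measure_right_down
      by (simp add: sw)
  next
    case False
    then have sw: "swap k T = Poly_Mapping.single (expand_box T (R, C)) (beta k (R, C)) +
        Poly_Mapping.single (expand_edge T (R, C)) 1"
      using v bullet by (simp add: swap_def lower_edge_def expansion_swap_eq Let_def)
    let ?b = "Min (elabels T (R, C))"
    have b: "?b \<in> elabels T (R, C)" using Min_in[OF finite_elabels False] .
    have "elabels (expand_edge T (R, C)) (R, C) = elabels T (R, C) - {?b}"
      using R_C by (auto simp: expand_edge_def Let_def upper_edge_def)
    then have "card (elabels (expand_edge T (R, C)) (R, C)) < card (elabels T (R, C))"
      using card_Diff1_less[OF finite_elabels b] by simp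
    moreover have "bullet (expand_edge T (R, C)) = Some (R, C)"
      "in_shape (expand_edge T (R, C)) = in_shape T"
      using bullet by (simp_all add: expand_edge_def Let_def)
    moreover have "\<not> can_swap (expand_box T (R, C))" "in_shape (expand_box T (R, C)) = in_shape T"
      by (simp_all add: can_swap_def expand_box_def)
    moreover have "Poly_Mapping.keys (swap k T) \<subseteq> {expand_box T (R, C), expand_edge T (R, C)}"
      unfolding sw by (rule order_trans[OF Poly_Mapping.keys_add]) (auto split: if_splits)
    ultimately show ?thesis
      using expand_box_good[OF v False refl] expand_edge_good[OF v False refl]
        expansion_swap_apwt[OF v False] bullet
      by (auto simp: sw lin_ext_add jdt_measure_def)
  qed
next
  case False
  obtain s where s: "label T (R, C + 1) = Some s" and h: "goes_horizontal T (R, C)"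
  proof -
    have "r_label T (R, C) \<noteq> None"
    proof
      assume "r_label T (R, C) = None"
      then have "b_label T (R, C) = None" using False by (simp add: goes_vertical_def)
      then show False using assms bullet \<open>r_label T (R, C) = None\<close>
        by (auto simp: can_swap_def b_label_def r_label_def lower_edge_def split: if_splits)
    qed
    then obtain s where s: "r_label T (R, C) = Some s" by blast
    then have "goes_horizontal T (R, C)"
      using False by (auto simp: goes_horizontal_def goes_vertical_def not_le)
    then show ?thesis using that s by (simp add: r_label_def right_of_def)
  qed
  \<comment> \<open>No label on the upper edge exceeds \<open>s\<close> by \<open>bullet_ok\<close>,
    so \<open>s\<close> lies there exactly if it is the largest label there. The case split is
    therefore that between rules III and IV.\<close>
  show ?thesis
  proof (cases "s \<in> elabels T (R - 1, C)")
    case True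
    have "Max (elabels T (R - 1, C)) = s"
      using True bullet_okD(2)[OF s] finite_elabels by (intro Max_eqI)
    then have "resuscitates T (R, C)"
      using h s True by (auto simp: resuscitates_def upper_edge_def r_label_def right_of_def)
    then have sw: "swap k T = Poly_Mapping.single (resuscitation_swap T (R, C)) 1"
      using False bullet by (simp add: swap_def)
    have "bullet (resuscitation_swap T (R, C)) = Some (R, C + 1)"
      "in_shape (resuscitation_swap T (R, C)) = in_shape T"
      by (simp_all add: resuscitation_swap_def Let_def right_of_def)
    then show ?thesis
      using resuscitation_swap_good[OF h s True] resuscitation_swap_apwt[OF h s True]
        jdt_measure_right_down by (simp add: sw)
  next
    case notin: False
    interpret bulleted_horizontal k n mu T R C s "horizontal_m T (R, C)"
      using h s notin by unfold_locales auto
    have "\<not> resuscitates T (R, C)"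
      using s notin Max_in[OF finite_elabels, of "(R - 1, C)"]
      by (auto simp: resuscitates_def upper_edge_def r_label_def right_of_def)
    then have sw: "swap k T = Poly_Mapping.single T' 1"
      using False bullet by (simp add: swap_def)
    show ?thesis
      using horizontal_swap_good horizontal_swap_apwt jdt_measure_right_down horizontal_swap_sel
      by (simp add: sw)
  qed
qed

end

text \<open>Serves both ends of a slide: the bullet enters at a corner of the inner shape and is
  erased at a corner of the outer one.\<close>

lemma young_diagram_remove:
  assumes "young_diagram D" "(R + 1, C) \<notin> D" "(R, C + 1) \<notin> D"
  shows "young_diagram (D - {(R, C)})"
  unfolding young_diagram_def
proof (intro conjI allI impI)
  show "finite (D - {(R, C)})" using assms by (simp add: young_diagram_def)
next
  fix r c assume rc: "(r, c) \<in> D - {(R, C)}"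
  show "1 \<le> r" "1 \<le> c" using rc assms by (auto simp: young_diagram_def)
  have "(R, C) \<notin> {1..r} \<times> {1..c}"
  proof
    assume "(R, C) \<in> {1..r} \<times> {1..c}"
    then have "1 \<le> R" "1 \<le> C" "R + 1 \<le> r \<or> C + 1 \<le> c" "R \<le> r" "C \<le> c" using rc by auto
    then show False using young_diagram_down[OF assms(1), of r c] rc assms(2,3) by auto
  qed
  moreover have "{1..r} \<times> {1..c} \<subseteq> D" using rc assms by (simp add: young_diagram_def)
  ultimately show "{1..r} \<times> {1..c} \<subseteq> D - {(R, C)}" by blast
qed

lemma occ_from_same: "label T' = label T \<Longrightarrow> elabels T' = elabels T \<Longrightarrow> occ_from T' = occ_from T"
  by (simp add: fun_eq_iff occ_from_def)

section \<open>Single slides, from placing the bullet to erasing it\<close>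

lemma put_bullet_correct:
  assumes good: "good k n mu T" and none: "bullet T = None" and x: "x \<in> inner_corners T"
  shows "good k n mu (put_bullet x T) \<and> apwt k (put_bullet x T) = apwt k T"
proof -
  let ?T = "put_bullet x T"
  obtain R C where xRC: "x = (R, C)" by fastforce
  have wf: "well_formed k n T" and cs: "column_strict T" and rw: "row_weak T"
    and lat: "lattice T" and ct: "content T = mu"
    using good by (auto simp: good_def)
  have RC: "(R, C) \<in> in_shape T" "(R + 1, C) \<notin> in_shape T" "(R, C + 1) \<notin> in_shape T"
    using x by (auto simp: xRC inner_corners_def inner_corners_of_def)
  have L: "label ?T = label T" and F: "elabels ?T = elabels T" and B: "bullet ?T = Some (R, C)"
    and I: "in_shape ?T = in_shape T - {(R, C)}" and O: "out_shape ?T = out_shape T"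
    by (simp_all add: put_bullet_def xRC)
  have young: "young_diagram (in_shape T)" "young_diagram (out_shape T)"
    and sub: "in_shape T \<subseteq> out_shape T"
    using wf by (auto simp: well_formed_def)
  have "well_formed k n ?T"
    using wf young_diagram_remove[OF young(1) RC(2,3)] RC(1) sub none
    unfolding well_formed_def L F B I O by auto
  moreover have left: "label T (R, C - 1) = None"
  proof (rule ccontr)
    assume "label T (R, C - 1) \<noteq> None"
    then obtain l where l: "label T (R, C - 1) = Some l" by blast
    note p = well_formed_label[OF wf l]
    show False using young_diagram_down[OF young(1) RC(1)] p by auto
  qed
  have up: "elabels T (R - 1, C) = {}"
  proof (rule ccontr)
    assume "elabels T (R - 1, C) \<noteq> {}"
    then obtain l where "l \<in> elabels T (R - 1, C)" by blast
    moreover have "1 \<le> R" using RC(1) young(1) by (auto simp: young_diagram_def)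
    ultimately show False using well_formed_edge(5)[OF wf] RC(1) by fastforce
  qed
  \<comment> \<open>At an inner corner neither the left neighbour nor the upper edge carries labels,
    so all conditions hold trivially. The empty upper edge also rules out a resuscitation.\<close>
  have "bullet_ok ?T"
    unfolding bullet_ok_def L F B using left up by simp
  moreover have "column_strict ?T" "row_weak ?T"
    using cs rw by (simp_all add: column_strict_def row_weak_def L F)
  moreover have "apwt k ?T = apwt k T"
    by (rule apwt_cong[OF L F]) (use none B up F in \<open>auto simp: resuscitates_def upper_edge_def\<close>)
  ultimately show ?thesis
    using lattice_content_cong[OF occ_from_same[OF L F]] lat ct by (simp add: good_def)
qed

text \<open>A bullet that cannot move has no label to its right or below. These places are then
  outside the outer shape, so the bullet occupies an outer corner, and removing it leaves a Young
  diagram.\<close>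

lemma erase_bullet_correct:
  assumes good: "good k n mu T" and stop: "\<not> can_swap T"
  shows "good k n mu (erase_bullet T) \<and> apwt k (erase_bullet T) = apwt k T \<and>
     bullet (erase_bullet T) = None \<and> in_shape (erase_bullet T) = in_shape T"
proof (cases "bullet T")
  case None
  then show ?thesis using good by (simp add: erase_bullet_def)
next
  case (Some x)
  obtain R C where xRC: "x = (R, C)" by fastforce
  interpret bulleted k n mu T R C using good Some xRC by unfold_locales auto
  let ?T = "erase_bullet T"
  have L: "label ?T = label T" and F: "elabels ?T = elabels T" and B: "bullet ?T = None"
    and I: "in_shape ?T = in_shape T" and O: "out_shape ?T = out_shape T - {(R, C)}"
    using Some xRC by (simp_all add: erase_bullet_def)
  have none: "label T (R, C + 1) = None" "elabels T (R, C) = {}" "label T (R + 1, C) = None"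
    using stop bullet by (auto simp: can_swap_def right_of_def below_def lower_edge_def)
  have "(R + 1, C) \<notin> out_shape T" "(R, C + 1) \<notin> out_shape T"
    using southeast_labelled[of "R + 1" C] southeast_labelled[of R "C + 1"] none by auto
  then have "young_diagram (out_shape T - {(R, C)})" by (rule young_diagram_remove[OF young_out])
  moreover have "(e, c) \<noteq> (R, C)" if "l \<in> elabels T (e, c)" for l e c
    using that none(2) by auto
  ultimately have "well_formed k n ?T"
    using wf bullet bullet_in unfolding well_formed_def L F B I O by auto
  moreover have "column_strict ?T" "row_weak ?T"
    using cs rw by (simp_all add: column_strict_def row_weak_def L F)
  moreover have "apwt k ?T = apwt k T"
    by (rule apwt_cong[OF L F])
      (use B bullet none in \<open>auto simp: resuscitates_def goes_horizontal_def r_label_def right_of_def\<close>)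
  ultimately show ?thesis
    using lattice_content_cong[OF occ_from_same[OF L F]] lat ct B I by (simp add: good_def bullet_ok_def)
qed

lemma Eqjdt_correct:
  assumes good: "good k n mu T" and none: "bullet T = None" and x: "x \<in> inner_corners T"
  shows "(\<forall>V \<in> Poly_Mapping.keys (Eqjdt k x T). good k n mu V \<and> bullet V = None \<and>
            in_shape V = in_shape T - {x}) \<and>
         lin_ext (apwt k) (Eqjdt k x T) = apwt k T"
proof -
  let ?start = "Poly_Mapping.single (put_bullet x T) (1 :: poly_t)"
  let ?P = "\<lambda>F :: tableau_sum. \<forall>U \<in> Poly_Mapping.keys F. \<not> can_swap U"
  \<comment> \<open>The budget \<open>j\<close> bounds the measure of those terms that can still
    swap; finished terms are carried along. At \<open>j = 0\<close> no term can swap.\<close>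
  define Q where "Q j F \<longleftrightarrow> (\<forall>U \<in> Poly_Mapping.keys F. good k n mu U \<and> in_shape U = in_shape T - {x} \<and>
      (can_swap U \<longrightarrow> jdt_measure n mu U < j)) \<and> lin_ext (apwt k) F = apwt k T"
    for j and F :: tableau_sum
  let ?F = "repeat_until (\<lambda>_. swap_step k) ?P ?start"
  have "?P ?F \<and> (\<exists>j. Q j ?F)"
  proof (rule repeat_until_reaches)
    show "Q (Suc (jdt_measure n mu (put_bullet x T))) ?start"
      unfolding Q_def using put_bullet_correct[OF assms] by (simp add: put_bullet_def)
  next
    fix j m :: nat and F assume Q: "Q (Suc j) F"
    have swap: "(\<forall>V \<in> Poly_Mapping.keys (swap k U). good k n mu V \<and> in_shape V = in_shape U \<and>
            (can_swap V \<longrightarrow> jdt_measure n mu V < jdt_measure n mu U)) \<and>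
         lin_ext (apwt k) (swap k U) = apwt k U"
      if "U \<in> Poly_Mapping.keys F" "can_swap U" for U
    proof -
      from that(2) obtain R C where "bullet U = Some (R, C)" by (auto simp: can_swap_def)
      then interpret bulleted k n mu U R C using Q that by unfold_locales (auto simp: Q_def)
      show ?thesis using swap_correct that by blast
    qed
    show "Q j (swap_step k F)"
      unfolding Q_def
    proof (intro conjI ballI)
      fix V assume "V \<in> Poly_Mapping.keys (swap_step k F)"
      then obtain U where U: "U \<in> Poly_Mapping.keys F"
        and V: "V \<in> Poly_Mapping.keys (if can_swap U then swap k U else Poly_Mapping.single U 1)"
        unfolding swap_step_def by (rule keys_substituteE)
      have "good k n mu U \<and> in_shape U = in_shape T - {x} \<and> (can_swap U \<longrightarrow> jdt_measure n mu U < Suc j)"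
        using Q U unfolding Q_def by blast
      then show "good k n mu V" "in_shape V = in_shape T - {x}" "can_swap V \<longrightarrow> jdt_measure n mu V < j"
        using V swap[OF U] by (auto split: if_splits)
    next
      have "lin_ext (apwt k) (swap_step k F) = lin_ext (apwt k) F"
        unfolding swap_step_def by (rule lin_ext_substitute_cong) (use swap in auto)
      then show "lin_ext (apwt k) (swap_step k F) = apwt k T" using Q by (simp add: Q_def)
    qed
  next
    show "?P F" if "Q 0 F" for F using that by (auto simp: Q_def)
  qed
  then have P: "?P ?F" and good_F: "\<forall>U \<in> Poly_Mapping.keys ?F. good k n mu U \<and> in_shape U = in_shape T - {x}"
    and lin: "lin_ext (apwt k) ?F = apwt k T"
    by (auto simp: Q_def)
  have J: "Eqjdt k x T = substitute (\<lambda>U. Poly_Mapping.single (erase_bullet U) 1) ?F"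
    by (simp add: Eqjdt_def)
  have E: "good k n mu (erase_bullet U) \<and> apwt k (erase_bullet U) = apwt k U \<and>
     bullet (erase_bullet U) = None \<and> in_shape (erase_bullet U) = in_shape T - {x}"
    if "U \<in> Poly_Mapping.keys ?F" for U
    using erase_bullet_correct[of k n mu U] P good_F that by auto
  have "lin_ext (apwt k) (Eqjdt k x T) = lin_ext (apwt k) ?F"
    unfolding J by (rule lin_ext_substitute_cong) (use E in auto)
  moreover have "good k n mu V \<and> bullet V = None \<and> in_shape V = in_shape T - {x}"
    if V: "V \<in> Poly_Mapping.keys (Eqjdt k x T)" for V
  proof -
    obtain U where "U \<in> Poly_Mapping.keys ?F"
      and "V \<in> Poly_Mapping.keys (Poly_Mapping.single (erase_bullet U) (1 :: poly_t))"
      using V unfolding J by (rule keys_substituteE)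
    then show ?thesis using E by (auto split: if_splits)
  qed
  ultimately show ?thesis using lin by simp
qed

text \<open>A box with the largest sum of row and column has no box to its right or below.\<close>

lemma inner_corner_exists:
  assumes "young_diagram D" "D \<noteq> {}"
  shows "inner_corners_of D \<noteq> {}"
proof -
  have fin: "finite D" using assms by (simp add: young_diagram_def)
  define N where "N = Max ((\<lambda>(r, c). r + c) ` D)"
  have "N \<in> (\<lambda>(r, c). r + c) ` D" unfolding N_def using fin assms(2) by (intro Max_in) auto
  then obtain r c where rc: "(r, c) \<in> D" "r + c = N" by auto
  have "r' + c' \<le> N" if "(r', c') \<in> D" for r' c'
    unfolding N_def using fin that by (intro Max_ge) force+
  then have "(r + 1, c) \<notin> D" "(r, c + 1) \<notin> D" using rc by fastforce+
  then show ?thesis using rc unfolding inner_corners_of_def by auto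
qed

lemma Eqrect_correct:
  assumes good: "good k n mu T" and none: "bullet T = None" and \<rho>: "rectification_order \<rho>"
  shows "(\<forall>V \<in> Poly_Mapping.keys (Eqrect k \<rho> T). good k n mu V \<and> bullet V = None \<and> in_shape V = {}) \<and>
         lin_ext (apwt k) (Eqrect k \<rho> T) = apwt k T"
proof -
  let ?P = "\<lambda>F :: tableau_sum. \<forall>U \<in> Poly_Mapping.keys F. inner_corners U = {}"
  \<comment> \<open>Each stage removes one box from every nonempty inner shape, so the number of
    inner boxes serves as budget. The order may depend on stage and term, as only this number
    matters.\<close>
  define Q where "Q j F \<longleftrightarrow> (\<forall>U \<in> Poly_Mapping.keys F. good k n mu U \<and> bullet U = None \<and>
      card (in_shape U) \<le> j) \<and> lin_ext (apwt k) F = apwt k T" for j and F :: tableau_sum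
  have young: "young_diagram (in_shape U)" if "good k n mu U" for U
    using that by (simp add: good_def well_formed_def)
  have empty: "in_shape U = {}" if "good k n mu U" "inner_corners U = {}" for U
    using inner_corner_exists[OF young[OF that(1)]] that(2) by (auto simp: inner_corners_def)
  let ?F = "Eqrect k \<rho> T"
  have "?P ?F \<and> (\<exists>j. Q j ?F)"
    unfolding Eqrect_def
  proof (rule repeat_until_reaches)
    show "Q (card (in_shape T)) (Poly_Mapping.single T 1)"
      unfolding Q_def using good none by simp
  next
    fix j m :: nat and F assume Q: "Q (Suc j) F"
    have jdt: "(\<forall>V \<in> Poly_Mapping.keys (Eqjdt k (\<rho> m U) U). good k n mu V \<and> bullet V = None \<and>
            in_shape V = in_shape U - {\<rho> m U}) \<and>
         lin_ext (apwt k) (Eqjdt k (\<rho> m U) U) = apwt k U" "\<rho> m U \<in> in_shape U"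
      if "U \<in> Poly_Mapping.keys F" "inner_corners U \<noteq> {}" for U
    proof -
      have "\<rho> m U \<in> inner_corners U" using \<rho> that(2) by (simp add: rectification_order_def)
      then show "\<rho> m U \<in> in_shape U" by (auto simp: inner_corners_def inner_corners_of_def)
      show "(\<forall>V \<in> Poly_Mapping.keys (Eqjdt k (\<rho> m U) U). good k n mu V \<and> bullet V = None \<and>
            in_shape V = in_shape U - {\<rho> m U}) \<and>
         lin_ext (apwt k) (Eqjdt k (\<rho> m U) U) = apwt k U"
        by (rule Eqjdt_correct) (use Q that(1) \<open>\<rho> m U \<in> inner_corners U\<close> in \<open>auto simp: Q_def\<close>)
    qed
    show "Q j (rect_step k (\<rho> m) F)"
      unfolding Q_def
    proof (intro conjI ballI)
      fix V assume "V \<in> Poly_Mapping.keys (rect_step k (\<rho> m) F)"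
      then obtain U where U: "U \<in> Poly_Mapping.keys F"
        and V: "V \<in> Poly_Mapping.keys
          (if inner_corners U \<noteq> {} then Eqjdt k (\<rho> m U) U else Poly_Mapping.single U 1)"
        unfolding rect_step_def by (rule keys_substituteE)
      have gU: "good k n mu U" "bullet U = None" "card (in_shape U) \<le> Suc j"
        using Q U unfolding Q_def by auto
      have "finite (in_shape U)" using young[OF gU(1)] by (simp add: young_diagram_def)
      then show "good k n mu V" "bullet V = None" "card (in_shape V) \<le> j"
        using V jdt[OF U] gU empty[OF gU(1)] by (auto split: if_splits)
    next
      have "lin_ext (apwt k) (rect_step k (\<rho> m) F) = lin_ext (apwt k) F"
        unfolding rect_step_def by (rule lin_ext_substitute_cong) (use jdt in auto)
      then show "lin_ext (apwt k) (rect_step k (\<rho> m) F) = apwt k T" using Q by (simp add: Q_def)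
    qed
  next
    show "?P F" if "Q 0 F" for F
    proof
      fix U assume "U \<in> Poly_Mapping.keys F"
      then have "good k n mu U" "card (in_shape U) = 0" using that by (auto simp: Q_def)
      then have "in_shape U = {}" using young[of U] by (simp add: young_diagram_def)
      then show "inner_corners U = {}" by (simp add: inner_corners_def inner_corners_of_def)
    qed
  qed
  then show ?thesis using empty by (auto simp: Q_def)
qed

section \<open>Straight shapes\<close>

context
  fixes k n :: nat and mu :: "nat \<Rightarrow> nat" and T :: tableau
  assumes good: "good k n mu T" and none: "bullet T = None" and straight: "in_shape T = {}"
begin

lemma straight_facts:
  shows "well_formed k n T" "column_strict T" "row_weak T" "lattice T" "content T = mu"
    "young_diagram (out_shape T)"
  using good by (auto simp: good_def well_formed_def)

lemma straight_labelled: "(\<exists>l. label T x = Some l) \<longleftrightarrow> x \<in> out_shape T"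
  using well_formed_label_iff[OF straight_facts(1), of x] none straight by simp

lemma straight_label_ge: "label T (r, c) = Some l \<Longrightarrow> r \<le> l"
proof (induction r arbitrary: l)
  case (Suc r)
  note p = well_formed_label[OF straight_facts(1) Suc.prems]
  show ?case
  proof (cases "r = 0")
    case True
    then show ?thesis using p by simp
  next
    case False
    then have "(r, c) \<in> out_shape T" using young_diagram_down[OF straight_facts(6) p(2)] p by auto
    then obtain l' where l': "label T (r, c) = Some l'" using straight_labelled by blast
    have "r \<le> l'" using Suc.IH[OF l'] .
    also have "l' < l" using column_strictD(1)[OF straight_facts(2) l' Suc.prems] by simp
    finally show ?thesis by simp
  qed
qed simp

text \<open>An edge label exceeds the box above it, whose label is at least its row
  \<open>e\<close>; on the top edge it exceeds 0. Without a bullet there is no exception.\<close>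

lemma straight_edge_apwt: "i \<in> elabels T (e, c) \<Longrightarrow> apwt k T = 0"
proof -
  assume i: "i \<in> elabels T (e, c)"
  note p = well_formed_edge[OF straight_facts(1) i]
  have "e < i"
  proof (cases "e = 0")
    case False
    then obtain l where l: "label T (e, c) = Some l" using p straight_labelled by blast
    then show ?thesis
      using straight_label_ge[OF l] column_strictD(2)[OF straight_facts(2) l i] by simp
  qed (use p in simp)
  then have "too_high T" by (rule too_highI(2)[OF i]) (simp add: none)
  then show ?thesis by (simp add: apwt_eq)
qed

lemma row_weak_le:
  assumes l: "label T (r, c) = Some l" and l': "label T (r, c') = Some l'" and "c \<le> c'"
  shows "l \<le> l'"
  using \<open>c \<le> c'\<close> l'
proof (induction arbitrary: l' rule: dec_induct)
  case base
  then show ?case using l by simp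
next
  case (step c')
  note p = well_formed_label[OF straight_facts(1) step.prems] and q = well_formed_label[OF straight_facts(1) l]
  have "(r, c') \<in> out_shape T" using young_diagram_down[OF straight_facts(6) p(2)] p q step by auto
  then obtain w where w: "label T (r, c') = Some w" using straight_labelled by blast
  have "w \<le> l'" using straight_facts(3) w step.prems unfolding row_weak_def by simp
  then show ?case using step.IH[OF w] by simp
qed

text \<open>In the first row with a label \<open>l > r\<close>, latticeness gives a copy of
  \<open>l - 1\<close> weakly to the right. Higher up it would equal its row, which is too small. In
  row \<open>r\<close> or below, the box of row \<open>r\<close> in its column would hold at most
  \<open>l - 1\<close> by its column but at least \<open>l\<close> by its row.\<close>

lemma straight_regular_label:
  assumes "\<And>e. elabels T e = {}"
  shows "label T (r, c) = Some l \<Longrightarrow> l = r"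
proof (induction r arbitrary: c l rule: less_induct)
  case (less r)
  note cs = straight_facts(2) and wf = straight_facts(1)
  note p = well_formed_label[OF wf less.prems]
  show ?case
  proof (rule ccontr)
    assume "l \<noteq> r"
    then have lr: "r < l" using straight_label_ge[OF less.prems] by simp
    have "occurs T c l" using less.prems unfolding occurs_def by blast
    then have "0 < occ_from T c l" using occ_from_pos[OF wf cs, of c l] by blast
    also have "occ_from T c l = occ_from T c ((l - 1) + 1)" using lr by simp
    also have "\<dots> \<le> occ_from T c (l - 1)"
      by (rule straight_facts(4)[unfolded lattice_def, rule_format]) (use p lr in auto)
    finally obtain c' where c': "c' \<ge> c" "occurs T c' (l - 1)" using occ_from_pos[OF wf cs] by blast
    then obtain r' where r': "label T (r', c') = Some (l - 1)" using assms unfolding occurs_def by auto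
    note q = well_formed_label[OF wf r']
    show False
    proof (cases "r' < r")
      case True
      then show ?thesis using less.IH[OF True r'] lr by simp
    next
      case False
      then have "(r, c') \<in> out_shape T" using young_diagram_down[OF straight_facts(6) q(2)] p q by auto
      then obtain w where w: "label T (r, c') = Some w" using straight_labelled by blast
      have "l \<le> w" using row_weak_le[OF less.prems w] c' by simp
      moreover have "w \<le> l - 1"
        using False w r' column_strictD(1)[OF cs w r'] by (cases "r = r'") auto
      ultimately show False using lr by simp
    qed
  qed
qed

text \<open>When every label equals its row, the content lists the row lengths; rows of a Young
  diagram are initial intervals, so the content determines the shape.\<close>

lemma straight_regular:
  assumes reg: "\<And>e. elabels T e = {}"
  shows "T = S_tab mu"
proof -
  note wf = straight_facts(1) and cs = straight_facts(2)
  have lab: "label T (r, c) = (if (r, c) \<in> out_shape T then Some r else None)" for r c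
    using straight_labelled[of "(r, c)"] straight_regular_label[OF reg, of r c]
    by (cases "label T (r, c)") auto
  have row: "mu i = card {c. (i, c) \<in> out_shape T}" for i
  proof -
    have "{c'. 0 \<le> c' \<and> occurs T c' i} = {c. (i, c) \<in> out_shape T}"
      by (auto simp: occurs_def reg lab split: if_splits)
    then show ?thesis
      unfolding straight_facts(5)[symmetric] content_eq_occ_from occ_from_eq[OF wf cs] by simp
  qed
  have interval: "{c. (i, c) \<in> out_shape T} = {1..mu i}" for i
  proof -
    let ?S = "{c. (i, c) \<in> out_shape T}"
    have fin: "finite ?S"
      by (rule finite_subset[of _ "{..n - k}"]) (use well_formed_out[OF wf] in auto)
    show ?thesis
    proof (cases "?S = {}")
      case True
      then show ?thesis by (simp add: row)
    next
      case False
      then have M: "Max ?S \<in> ?S" using Max_in[OF fin] by blast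
      have "?S = {1..Max ?S}"
      proof (intro equalityI subsetI)
        fix c assume "c \<in> ?S"
        then show "c \<in> {1..Max ?S}" using fin well_formed_out(3)[OF wf] by auto
      next
        fix c assume "c \<in> {1..Max ?S}"
        then show "c \<in> ?S"
          using M young_diagram_down[OF straight_facts(6), of i "Max ?S" i c] well_formed_out[OF wf] by auto
      qed
      then show ?thesis by (metis row card_atLeastAtMost diff_Suc_1 Suc_eq_plus1)
    qed
  qed
  have out: "out_shape T = diagram_of mu"
  proof (intro equalityI subsetI)
    fix x assume x: "x \<in> out_shape T"
    obtain i j where ij: "x = (i, j)" by fastforce
    have "j \<in> {1..mu i}" using x unfolding interval[symmetric] ij by simp
    then show "x \<in> diagram_of mu" using x well_formed_out(1)[OF wf] by (simp add: ij diagram_of_def)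
  next
    fix x assume "x \<in> diagram_of mu"
    then obtain i j where ij: "x = (i, j)" "j \<in> {1..mu i}" by (auto simp: diagram_of_def)
    then show "x \<in> out_shape T" unfolding interval[symmetric] by simp
  qed
  show ?thesis
    unfolding S_tab_def using straight none out reg lab
    by (intro tableau.equality) (auto simp: fun_eq_iff)
qed

end

lemma apwt_S_tab: "apwt k (S_tab mu) = 1"
proof -
  have "\<not> too_high (S_tab mu)"
    by (auto simp: S_tab_def split: if_splits elim!: too_highE)
  moreover have "edge_labels (S_tab mu) = {}" by (simp add: edge_labels_def S_tab_def)
  ultimately show ?thesis by (simp add: apwt_eq)
qed

text \<open>\<open>semistandard\<close> compares neighbours only. Columns of a skew shape are
  connected and without a bullet every box is labelled, so neighbours chain up to all pairs; between
  two distinct labelled edges of a column there is always a box.\<close>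

lemma filling_good:
  assumes young: "young_diagram lam" "young_diagram nu" and sub: "lam \<subseteq> nu" "nu \<subseteq> rectangle k n"
    and fill: "equivariant_filling k n lam nu T"
    and ss: "semistandard T" and lat: "lattice T"
  shows "good k n (content T) T"
proof -
  have T: "in_shape T = lam" "out_shape T = nu" "bullet T = None" "dom (label T) = nu - lam"
    using fill by (auto simp: equivariant_filling_def)
  have edge: "1 \<le> l \<and> c \<in> {1..n - k} \<and> (e = 0 \<or> (e, c) \<in> nu) \<and> (e + 1, c) \<notin> lam"
    if "l \<in> elabels T (e, c)" for e c l
  proof -
    have "(e, c) \<in> horizontal_edges k n lam nu" "1 \<le> l"
      using fill that unfolding equivariant_filling_def by blast+
    then show ?thesis
      using sub by (auto simp: horizontal_edges_def southern_border_def rectangle_def subset_iff)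
  qed
  have wf: "well_formed k n T"
    unfolding well_formed_def T using young sub edge fill by (auto simp: equivariant_filling_def)
  have labelled: "\<exists>l. label T x = Some l" if "x \<in> nu" "x \<notin> lam" for x
    using well_formed_label_iff[OF wf, of x] T that by simp
  have between: "\<exists>l. label T (r, c) = Some l"
    if "(p, c) \<notin> lam" "(q, c) \<in> nu" "1 \<le> p" "p \<le> r" "r \<le> q" for p q r c
  proof -
    have "1 \<le> c" using that(2) young by (auto simp: young_diagram_def)
    then show ?thesis
      using labelled young_diagram_down[OF young(1), of r c p c] young_diagram_down[OF young(2), of q c r c] that
      by auto
  qed
  have step: "l < l'" if "label T (r, c) = Some l" "label T (Suc r, c) = Some l'" for r c l l'
    using ss that unfolding semistandard_def by simp
  have bb: "l < l'" if l: "label T (r, c) = Some l" "label T (r', c) = Some l'" "r < r'" for r r' c l l'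
    using l(3,2)
  proof (induction r' arbitrary: l')
    case (Suc r')
    show ?case
    proof (cases "r = r'")
      case True
      then show ?thesis using step l(1) Suc.prems by blast
    next
      case False
      then have "r < r'" using Suc.prems by simp
      moreover obtain w where w: "label T (r', c) = Some w"
        using between[of r c "Suc r'" r'] well_formed_label[OF wf l(1)] well_formed_label[OF wf Suc.prems(2)]
          T \<open>r < r'\<close> by auto
      ultimately have "l < w" using Suc.IH by blast
      then show ?thesis using step[OF w Suc.prems(2)] by simp
    qed
  qed simp
  have be: "l < l'" if l: "label T (r, c) = Some l" "l' \<in> elabels T (e, c)" "r \<le> e" for r e c l l'
  proof -
    note p = well_formed_label[OF wf l(1)]
    have "(e, c) \<in> nu" using edge[OF l(2)] p l(3) by auto
    then obtain w where w: "label T (e, c) = Some w" using between[of r c e e] p T l(3) by auto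
    have "l \<le> w" using bb[OF l(1) w] l w by (cases "r = e") auto
    also have "w < l'" using ss w l(2) unfolding semistandard_def by blast
    finally show ?thesis .
  qed
  have next_box: "\<exists>w. label T (e + 1, c) = Some w \<and> l < w"
    if l: "l \<in> elabels T (e, c)" "(q, c) \<in> nu" "e < q" for l e c q
  proof -
    obtain w where w: "label T (e + 1, c) = Some w"
      using between[of "e + 1" c q "e + 1"] edge[OF l(1)] l by auto
    have "\<forall>l' \<in> elabels T (e + 1 - 1, c). l' < w" using ss w unfolding semistandard_def by blast
    then show ?thesis using w l(1) by simp
  qed
  have eb: "l < l'" if l: "l \<in> elabels T (e, c)" "label T (r, c) = Some l'" "e < r" for r e c l l'
  proof -
    obtain w where w: "label T (e + 1, c) = Some w" "l < w"
      using next_box[OF l(1) _ l(3)] well_formed_label(2)[OF wf l(2)] T by auto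
    have "w \<le> l'" using bb[OF w(1) l(2)] w l by (cases "r = e + 1") auto
    then show ?thesis using w by simp
  qed
  have ee: "l < l'" if l: "l \<in> elabels T (e, c)" "l' \<in> elabels T (e', c)" "e < e'" for e e' c l l'
  proof -
    obtain w where w: "label T (e + 1, c) = Some w" "l < w"
      using next_box[OF l(1) _ l(3)] edge[OF l(2)] l(3) by auto
    then show ?thesis using be[OF w(1) l(2)] l(3) by simp
  qed
  have "column_strict T" unfolding column_strict_def using bb be eb ee by blast
  moreover have "row_weak T" using ss unfolding semistandard_def row_weak_def by blast
  ultimately show ?thesis using wf lat T by (simp add: good_def bullet_ok_def)
qed

theorem theorem2p3:
  fixes k n :: nat and lam nu :: "box set" and T :: tableau and mu :: "nat \<Rightarrow> nat"
  assumes "k \<le> n"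
    and "young_diagram lam" and "young_diagram nu"
    and "lam \<subseteq> nu" and "nu \<subseteq> rectangle k n"
    and "equivariant_filling k n lam nu T"
    and "semistandard T" and "lattice T" and "content T = mu"
  shows "(\<forall>\<rho>. rectification_order \<rho> \<longrightarrow> highest_weight mu (Eqrect k \<rho> T)) \<and>
    (\<forall>\<rho> \<sigma>. rectification_order \<rho> \<and> rectification_order \<sigma> \<longrightarrow>
       Poly_Mapping.lookup (Eqrect k \<rho> T) (S_tab mu) =
       Poly_Mapping.lookup (Eqrect k \<sigma> T) (S_tab mu)) \<and>
    (\<forall>\<rho>. rectification_order \<rho> \<longrightarrow>
       Poly_Mapping.lookup (Eqrect k \<rho> T) (S_tab mu) = apwt k T)"
proof -
  have good: "good k n mu T" using filling_good assms by blast
  have none: "bullet T = None" using assms by (simp add: equivariant_filling_def)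
  have hw: "highest_weight mu (Eqrect k \<rho> T)"
    and coeff: "Poly_Mapping.lookup (Eqrect k \<rho> T) (S_tab mu) = apwt k T"
    if \<rho>: "rectification_order \<rho>" for \<rho>
  proof -
    let ?F = "Eqrect k \<rho> T"
    have F: "good k n mu V" "bullet V = None" "in_shape V = {}" if "V \<in> Poly_Mapping.keys ?F" for V
      using Eqrect_correct[OF good none \<rho>] that by auto
    show "highest_weight mu ?F"
      unfolding highest_weight_def
    proof (intro allI impI)
      fix U assume U: "regular U \<and> Poly_Mapping.lookup ?F U \<noteq> 0"
      then have "U \<in> Poly_Mapping.keys ?F" by (simp add: in_keys_iff)
      then show "U = S_tab mu" using U by (intro straight_regular[OF F]) (auto simp: regular_def)
    qed
    have "apwt k V = (if V = S_tab mu then 1 else 0)" if "V \<in> Poly_Mapping.keys ?F" for V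
    proof (cases "\<exists>e c i. i \<in> elabels V (e, c)")
      case True
      then have "apwt k V = 0" using straight_edge_apwt[OF F[OF that]] by blast
      \<comment> \<open>Since \<open>S_tab mu\<close> has weight 1, weight 0 also shows that
        \<open>V\<close> is a different tableau.\<close>
      then show ?thesis using apwt_S_tab[of k mu] by auto
    next
      case False
      then have "V = S_tab mu" using straight_regular[OF F[OF that]] by auto
      then show ?thesis by (simp add: apwt_S_tab)
    qed
    then have "lin_ext (apwt k) ?F = (\<Sum>V \<in> Poly_Mapping.keys ?F. if V = S_tab mu then Poly_Mapping.lookup ?F V else 0)"
      unfolding lin_ext_def by (intro sum.cong) auto
    also have "\<dots> = Poly_Mapping.lookup ?F (S_tab mu)"
      by (simp add: in_keys_iff)
    finally show "Poly_Mapping.lookup ?F (S_tab mu) = apwt k T"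
      using Eqrect_correct[OF good none \<rho>] by simp
  qed
  show ?thesis using hw coeff by simp
qed

end
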